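(* Let $\nu>0$ and $0<b<c$. Let $(R_u^{(-\nu)})_{0\le u\le T_0}$ be the Bessel process of index $-\nu$ (equivalently, of dimension $2(1-\nu)$) started at $R_0^{(-\nu)}=1$ and considered up to its first hitting time $T_0$ of $0$. Let $$\sigma:=\inf\Big\{u\ge 0 : (R_u^{(-\nu)})^2=\tfrac1c\,(b+u)\Big\}.$$ Then for every real $s\ge 0$, $$E\big[(b+\sigma)^{-s}\big]=c^{-s}\,\frac{E\big[(1+2b\,\gamma_{\nu+s})^{-s}\big]}{E\big[(1+2c\,\gamma_{\nu+s})^{-s}\big]},$$ where $\gamma_{\nu+s}$ denotes a gamma random variable with parameter $\nu+s$.
   Context: For $\nu>0$, the Bessel process of index $-\nu$ (dimension $\delta=2(1-\nu)$) started at $1$ is the $\mathbb{R}_+$-valued diffusion $(R_u^{(-\nu)},\,u\le T_0)$, where $T_0:=\inf\{u: R_u^{(-\nu)}=0\}$, with infinitesimal generator $$\mathcal{L}^{(-\nu)}f(x)=\tfrac12 f''(x)+\frac{1-2\nu}{2x}f'(x),\qquad f\in C_b^2((0,\infty)).$$ For $a>0$, $\gamma_a$ denotes a gamma random variable with parameter $a$, i.e. with density $\frac{1}{\Gamma(a)}x^{a-1}e^{-x}$ on $(0,\infty)$. *)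

theory Defs
  imports "HOL-Probability.Probability"
begin

definition C2_bounded :: "(real \<Rightarrow> real) \<Rightarrow> bool" where
  "C2_bounded f \<longleftrightarrow>
     (\<forall>x>0. f differentiable (at x) \<and> deriv f differentiable (at x)) \<and>
     continuous_on {0<..} (deriv (deriv f)) \<and>
     bounded (f ` {0<..}) \<and> bounded (deriv f ` {0<..}) \<and> bounded (deriv (deriv f) ` {0<..})"

text \<open>The parameter \<open>\<nu>\<close> is minus the index, so the dimension is \<open>2 * (1 - \<nu>)\<close>.\<close>

definition bessel_generator :: "real \<Rightarrow> (real \<Rightarrow> real) \<Rightarrow> real \<Rightarrow> real" where
  "bessel_generator \<nu> f x = deriv (deriv f) x / 2 + (1 - 2 * \<nu>) / (2 * x) * deriv f x"

definition hitting_time :: "(real \<Rightarrow> 'a \<Rightarrow> real) \<Rightarrow> real \<Rightarrow> 'a \<Rightarrow> ereal" where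
  "hitting_time R y \<omega> = Inf (ereal ` {u. 0 \<le> u \<and> R u \<omega> = y})"

definition natural_filtration :: "'a measure \<Rightarrow> (real \<Rightarrow> 'a \<Rightarrow> real) \<Rightarrow> real \<Rightarrow> 'a measure" where
  "natural_filtration M R t =
     sigma (space M) {R u -` B \<inter> space M | u B. 0 \<le> u \<and> u \<le> t \<and> B \<in> sets borel}"

definition martingale :: "'a measure \<Rightarrow> (real \<Rightarrow> 'a measure) \<Rightarrow> (real \<Rightarrow> 'a \<Rightarrow> real) \<Rightarrow> bool" where
  "martingale M F X \<longleftrightarrow>
     (\<forall>t\<ge>0. X t \<in> borel_measurable (F t) \<and> integrable M (X t)) \<and>
     (\<forall>s\<ge>0. \<forall>t\<ge>s. AE \<omega> in M. real_cond_exp M (F s) (X t) \<omega> = X s \<omega>)"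

text \<open>
  The process \<open>f (R t) - f (R 0) - \<integral>\<^sub>0\<^sup>t L f (R v) dv\<close>, with \<open>L\<close> the generator,
  stopped when \<open>R\<close> hits \<open>\<epsilon>\<close>.
\<close>

definition generator_process ::
  "real \<Rightarrow> (real \<Rightarrow> 'a \<Rightarrow> real) \<Rightarrow> (real \<Rightarrow> real) \<Rightarrow> real \<Rightarrow> real \<Rightarrow> 'a \<Rightarrow> real" where
  "generator_process \<nu> R f \<epsilon> t \<omega> =
     (let \<tau> = real_of_ereal (min (ereal t) (hitting_time R \<epsilon> \<omega>))
      in f (R \<tau> \<omega>) - f (R 0 \<omega>) - (LINT v:{0..\<tau>}|lborel. bessel_generator \<nu> f (R v \<omega>)))"

text \<open>
  The diffusion with this generator, started at \<open>x\<close> and considered up to its hitting time of 0,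
  is described by its martingale problem. Since the drift coefficient is unbounded near 0, the
  martingale property is required up to the hitting times of the levels \<open>\<epsilon> > 0\<close>, which increase
  to the hitting time of 0. Paths are indexed by all of \<open>[0, \<infinity>)\<close>; beyond the hitting
  time of 0 they are only assumed to be nonnegative and continuous (for instance, absorbed at 0).
\<close>

definition bessel_process :: "'a measure \<Rightarrow> real \<Rightarrow> real \<Rightarrow> (real \<Rightarrow> 'a \<Rightarrow> real) \<Rightarrow> bool" where
  "bessel_process M \<nu> x R \<longleftrightarrow>
     (\<forall>u\<ge>0. R u \<in> borel_measurable M) \<and>
     (\<forall>\<omega>\<in>space M. R 0 \<omega> = x \<and> (\<forall>u\<ge>0. 0 \<le> R u \<omega>) \<and> continuous_on {0..} (\<lambda>u. R u \<omega>)) \<and>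
     (\<forall>f \<epsilon>. C2_bounded f \<longrightarrow> 0 < \<epsilon> \<longrightarrow> \<epsilon> < x \<longrightarrow>
        martingale M (natural_filtration M R) (generator_process \<nu> R f \<epsilon>))"

text \<open>The infimum ranges over the lifetime of the process; it is \<open>\<infinity>\<close> if there is no crossing.\<close>

definition crossing_time :: "(real \<Rightarrow> 'a \<Rightarrow> real) \<Rightarrow> real \<Rightarrow> real \<Rightarrow> 'a \<Rightarrow> ereal" where
  "crossing_time R b c \<omega> =
     Inf (ereal ` {u. 0 \<le> u \<and> ereal u \<le> hitting_time R 0 \<omega> \<and> (R u \<omega>)\<^sup>2 = 1 / c * (b + u)})"

definition gamma_density :: "real \<Rightarrow> real \<Rightarrow> real" where
  "gamma_density a x = (if 0 < x then 1 / Gamma a * x powr (a - 1) * exp (- x) else 0)"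

end

theory Submission
  imports Defs "HOL-Real_Asymp.Real_Asymp"
begin

text \<open>
  For \<open>s > 0\<close>, let \<open>F(t, x) = E[(x\<^sup>2 + 2 (b + t) \<gamma>)\<^sup>-\<^sup>s]\<close> with \<open>\<gamma>\<close> gamma distributed of parameter
  \<open>\<nu> + s\<close>. Integration by parts against the gamma density shows that \<open>F\<close> is space-time harmonic for
  the Bessel generator, and it is bounded on \<open>x \<ge> \<epsilon> = sqrt (b/c)\<close>, which is where the path stays up
  to \<open>\<sigma>\<close>. Hence \<open>E[F(\<sigma>, R\<^sub>\<sigma>)] = F(0, 1)\<close>, the contribution of \<open>\<sigma> = \<infinity>\<close> vanishing since then
  \<open>F(t, R\<^sub>t) \<le> ((b + t)/c)\<^sup>-\<^sup>s\<close>. On the crossing boundary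
  \<open>F(\<sigma>, R\<^sub>\<sigma>) = (b + \<sigma>)\<^sup>-\<^sup>s E[(1/c + 2 \<gamma>)\<^sup>-\<^sup>s]\<close>, which gives the formula. For \<open>s = 0\<close> it says that
  \<open>\<sigma>\<close> is almost surely finite.

  The martingale problem is only given for functions of space. Optional stopping for \<open>F\<close> is obtained
  on a time grid, using in each grid interval the martingale of \<open>F(u, \<cdot>)\<close> with \<open>u\<close> the left end
  point, and letting the mesh tend to 0 path by path.
\<close>

section \<open>Negative moments of shifted gamma variables\<close>

definition gamma_measure :: "real \<Rightarrow> real measure" where
  "gamma_measure a = density lborel (\<lambda>x. ennreal (gamma_density a x))"

text \<open>For a, y > 0 this is 2^(-a) y^(a - p) times Tricomi's confluent hypergeometric function
  U(a, a - p + 1, y/2).\<close>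

definition gamma_resolvent :: "real \<Rightarrow> real \<Rightarrow> real \<Rightarrow> real" where
  "gamma_resolvent a p y = (\<integral>x. (y + 2 * x) powr (- p) \<partial>gamma_measure a)"

lemma gamma_density_nonneg: "a > 0 \<Longrightarrow> 0 \<le> gamma_density a x"
  by (auto simp: gamma_density_def intro!: divide_nonneg_pos Gamma_real_nonneg)

lemma gamma_density_measurable [measurable]: "gamma_density a \<in> borel_measurable borel"
  unfolding gamma_density_def[abs_def] by measurable

lemma sets_gamma_measure [measurable_cong, simp]: "sets (gamma_measure a) = sets borel"
  by (simp add: gamma_measure_def)

lemma space_gamma_measure [simp]: "space (gamma_measure a) = UNIV"
  by (simp add: gamma_measure_def)

lemma AE_gamma_measure_pos: "AE x in gamma_measure a. 0 < x"
  unfolding gamma_measure_def by (subst AE_density) (auto simp: gamma_density_def)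

lemma prob_space_gamma_measure:
  assumes "a > 0"
  shows "prob_space (gamma_measure a)"
proof
  have G: "Gamma a > 0" using assms by (rule Gamma_real_pos)
  have "emeasure (gamma_measure a) (space (gamma_measure a)) = (\<integral>\<^sup>+x. gamma_density a x \<partial>lborel)"
    by (simp add: gamma_measure_def emeasure_density)
  also have "\<dots> = (\<integral>\<^sup>+x. ennreal (1 / Gamma a) * ennreal (indicator {0..} x * (x powr (a - 1) / exp x)) \<partial>lborel)"
  proof (intro nn_integral_cong_AE)
    have "AE x in lborel. x \<noteq> (0::real)" by (rule AE_lborel_singleton)
    then show "AE x in lborel. ennreal (gamma_density a x)
        = ennreal (1 / Gamma a) * ennreal (indicator {0..} x * (x powr (a - 1) / exp x))"
      by eventually_elim
        (use G in \<open>auto simp: gamma_density_def ennreal_mult'[symmetric] exp_minus field_simps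
          split: split_indicator\<close>)
  qed
  also have "\<dots> = ennreal (1 / Gamma a) * ennreal (Gamma a)"
    using nn_integral_has_integral_lebesgue[OF _ Gamma_integral_real[OF assms]]
    by (subst nn_integral_cmult) auto
  also have "\<dots> = 1"
    using G by (simp add: ennreal_mult'[symmetric])
  finally show "emeasure (gamma_measure a) (space (gamma_measure a)) = 1" .
qed

lemma integral_gamma_measure:
  assumes "a > 0" "f \<in> borel_measurable borel"
  shows "(\<integral>x. f x \<partial>gamma_measure a) = (\<integral>x. gamma_density a x * f x \<partial>lborel)"
  unfolding gamma_measure_def
  by (subst integral_density) (use assms gamma_density_nonneg in auto)

lemma integrable_gamma_measure_powr:
  assumes "a > 0" "y > 0" "p \<ge> 0"
  shows "integrable (gamma_measure a) (\<lambda>x. (y + 2 * x) powr (- p))"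
proof -
  interpret prob_space "gamma_measure a" by (rule prob_space_gamma_measure) fact
  show ?thesis
  proof (rule integrable_const_bound)
    show "AE x in gamma_measure a. norm ((y + 2 * x) powr (- p)) \<le> y powr (- p)"
      using AE_gamma_measure_pos[of a]
      by eventually_elim (use assms in \<open>auto intro!: powr_mono2'\<close>)
  qed measurable
qed

lemma gamma_resolvent_le:
  assumes "a > 0" "y > 0" "p \<ge> 0"
  shows "gamma_resolvent a p y \<le> y powr (- p)"
proof -
  interpret prob_space "gamma_measure a" by (rule prob_space_gamma_measure) fact
  have "gamma_resolvent a p y \<le> (\<integral>x. y powr (- p) \<partial>gamma_measure a)"
    unfolding gamma_resolvent_def
    by (rule integral_mono_AE)
      (use AE_gamma_measure_pos[of a] assms integrable_gamma_measure_powr in \<open>auto intro!: powr_mono2'\<close>)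
  then show ?thesis using prob_space by simp
qed

lemma gamma_resolvent_nonneg: "0 \<le> gamma_resolvent a p y"
  unfolding gamma_resolvent_def by (rule Bochner_Integration.integral_nonneg) simp

lemma gamma_resolvent_pos:
  assumes "a > 0" "y > 0" "p \<ge> 0"
  shows "0 < gamma_resolvent a p y"
proof -
  interpret prob_space "gamma_measure a" by (rule prob_space_gamma_measure) fact
  have "gamma_resolvent a p y \<noteq> 0"
  proof
    assume "gamma_resolvent a p y = 0"
    then have "AE x in gamma_measure a. (y + 2 * x) powr (- p) = 0"
      unfolding gamma_resolvent_def
      using integral_nonneg_eq_0_iff_AE[OF integrable_gamma_measure_powr[OF assms]] by simp
    with AE_gamma_measure_pos[of a] have "AE x in gamma_measure a. False"
      by eventually_elim (use assms in auto)
    then show False by simp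
  qed
  with gamma_resolvent_nonneg[of a p y] show ?thesis by simp
qed

lemma powr_one_plus_scale:
  fixes d x s :: real
  assumes "d > 0" "x > 0"
  shows "(1 + 2 * d * x) powr (- s) = d powr (- s) * (1 / d + 2 * x) powr (- s)"
proof -
  have "1 + 2 * d * x = d * (1 / d + 2 * x)" using assms by (simp add: field_simps)
  then show ?thesis using assms by (simp add: powr_mult)
qed

lemma gamma_expectation:
  assumes "distributed N lborel G (\<lambda>x. ennreal (gamma_density a x))" "a > 0" "d > 0"
  shows "(\<integral>\<omega>. (1 + 2 * d * G \<omega>) powr (- s) \<partial>N) = d powr (- s) * gamma_resolvent a s (1 / d)"
proof -
  have "(\<integral>\<omega>. (1 + 2 * d * G \<omega>) powr (- s) \<partial>N) = (\<integral>x. gamma_density a x * (1 + 2 * d * x) powr (- s) \<partial>lborel)"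
    by (rule distributed_integral[OF assms(1), symmetric]) (use assms gamma_density_nonneg in auto)
  also have "\<dots> = (\<integral>x. (1 + 2 * d * x) powr (- s) \<partial>gamma_measure a)"
    by (rule integral_gamma_measure[symmetric]) (use assms in auto)
  also have "\<dots> = (\<integral>x. d powr (- s) * (1 / d + 2 * x) powr (- s) \<partial>gamma_measure a)"
    by (rule integral_cong_AE)
      (use AE_gamma_measure_pos[of a] powr_one_plus_scale assms in auto)
  finally show ?thesis by (simp add: gamma_resolvent_def)
qed

text \<open>The two sides are E[(1 + 2 c \<gamma>)^(-s)] and E[(1 + 2 b \<gamma>)^(-s)], and the
  integrand decreases in the coefficient. It serves as the lower bound when s tends to 0 in
  \<open>prob_bessel_crosses\<close>.\<close>

lemma gamma_resolvent_scaled_antimono: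
  assumes "a > 0" "s \<ge> 0" "0 < b" "b \<le> c"
  shows "c powr (- s) * gamma_resolvent a s (1 / c) \<le> b powr (- s) * gamma_resolvent a s (1 / b)"
  unfolding gamma_resolvent_def Bochner_Integration.integral_mult_right_zero[symmetric]
proof (rule integral_mono_AE)
  show "AE x in gamma_measure a. c powr - s * (1 / c + 2 * x) powr - s \<le> b powr - s * (1 / b + 2 * x) powr - s"
    using AE_gamma_measure_pos[of a]
  proof eventually_elim
    fix x :: real assume x: "x > 0"
    have "(1 + 2 * c * x) powr (- s) \<le> (1 + 2 * b * x) powr (- s)"
      using assms x by (intro powr_mono2') (auto intro: add_pos_pos mult_right_mono)
    then show "c powr - s * (1 / c + 2 * x) powr - s \<le> b powr - s * (1 / b + 2 * x) powr - s"
      using assms x by (simp add: powr_one_plus_scale)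
  qed
qed (use assms in \<open>auto intro!: integrable_mult_right integrable_gamma_measure_powr\<close>)

lemma gamma_resolvent_0: "a > 0 \<Longrightarrow> y > 0 \<Longrightarrow> gamma_resolvent a 0 y = 1"
proof -
  assume a: "a > 0" and y: "y > 0"
  interpret prob_space "gamma_measure a" by (rule prob_space_gamma_measure) fact
  have "gamma_resolvent a 0 y = (\<integral>x. 1 \<partial>gamma_measure a)"
    unfolding gamma_resolvent_def
    by (rule integral_cong_AE) (use AE_gamma_measure_pos[of a] y in auto)
  then show ?thesis using prob_space by simp
qed

text \<open>Negative powers are Lipschitz away from 0. This supplies the constant that dominates the
  difference quotients when differentiating under the gamma integral.\<close>

lemma powr_difference_quotient_bound:
  fixes w z m p :: real
  assumes "0 < m" "m \<le> w" "m \<le> z" "p \<ge> 0"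
  shows "\<bar>w powr (- p) - z powr (- p)\<bar> \<le> p * m powr (- p - 1) * \<bar>w - z\<bar>"
proof -
  have "norm (w powr (- p) - z powr (- p)) \<le> p * m powr (- p - 1) * norm (w - z)"
  proof (rule field_differentiable_bound[where S = "{m..}" and f' = "\<lambda>x. - p * x powr (- p - 1)"])
  fix x assume "x \<in> {m..}"
  then have "x > 0" "m \<le> x" using assms by auto
  then show "((\<lambda>x. x powr - p) has_field_derivative - p * x powr (- p - 1)) (at x within {m..})"
    using has_real_derivative_powr[of x "- p"] has_field_derivative_at_within by blast
  show "norm (- p * x powr (- p - 1)) \<le> p * m powr (- p - 1)"
    using \<open>m \<le> x\<close> assms by (auto simp: abs_mult intro!: mult_left_mono powr_mono2')
  qed (use assms in auto)
  then show ?thesis by simp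
qed

lemma gamma_resolvent_has_real_derivative:
  assumes a: "a > 0" and y: "y > 0" and p: "p \<ge> 0"
  shows "(gamma_resolvent a p has_real_derivative - p * gamma_resolvent a (p + 1) y) (at y)"
proof -
  interpret prob_space "gamma_measure a" by (rule prob_space_gamma_measure) fact
  have "((\<lambda>z. (gamma_resolvent a p z - gamma_resolvent a p y) / (z - y))
      \<longlongrightarrow> - p * gamma_resolvent a (p + 1) y) (at y)"
    unfolding tendsto_at_iff_sequentially comp_def
  proof (intro allI impI)
    fix X :: "nat \<Rightarrow> real"
    assume X: "\<forall>i. X i \<in> UNIV - {y}" and lim: "X \<longlonglongrightarrow> y"
    define q where "q i x = ((X i + 2 * x) powr (- p) - (y + 2 * x) powr (- p)) / (X i - y)" for i x
    \<comment> \<open>From \<open>i0\<close> on, both points of the quotient stay above y/2, so a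
      single constant dominates.\<close>
    obtain i0 where i0: "\<And>i. i \<ge> i0 \<Longrightarrow> X i > y / 2"
      using order_tendstoD(1)[OF lim, of "y / 2"] y unfolding eventually_sequentially by auto
    have "(\<lambda>i. \<integral>x. q (i + i0) x \<partial>gamma_measure a) \<longlonglongrightarrow> (\<integral>x. - p * (y + 2 * x) powr (- (p + 1)) \<partial>gamma_measure a)"
    proof (rule integral_dominated_convergence[where w = "\<lambda>_. p * (y / 2) powr (- p - 1)"])
      show "AE x in gamma_measure a. (\<lambda>i. q (i + i0) x) \<longlonglongrightarrow> - p * (y + 2 * x) powr (- (p + 1))"
        using AE_gamma_measure_pos[of a]
      proof eventually_elim
        fix x :: real assume "x > 0"
        then have "((\<lambda>z. (z + 2 * x) powr (- p)) has_real_derivative - p * (y + 2 * x) powr (- (p + 1))) (at y)"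
          using y by (auto intro!: derivative_eq_intros simp: add_pos_pos)
        then have "(\<lambda>i. q i x) \<longlonglongrightarrow> - p * (y + 2 * x) powr (- (p + 1))"
          unfolding has_field_derivative_iff tendsto_at_iff_sequentially comp_def q_def
          using X lim by auto
        then show "(\<lambda>i. q (i + i0) x) \<longlonglongrightarrow> - p * (y + 2 * x) powr (- (p + 1))"
          by (rule LIMSEQ_ignore_initial_segment)
      qed
      fix i
      show "AE x in gamma_measure a. norm (q (i + i0) x) \<le> p * (y / 2) powr (- p - 1)"
        using AE_gamma_measure_pos[of a]
      proof eventually_elim
        fix x :: real assume "x > 0"
        then show "norm (q (i + i0) x) \<le> p * (y / 2) powr (- p - 1)"
          using powr_difference_quotient_bound[of "y / 2" "X (i + i0) + 2 * x" "y + 2 * x" p]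
            i0[of "i + i0"] X y p
          by (simp add: q_def divide_simps)
      qed
    qed (simp_all add: q_def)
    also have "(\<integral>x. - p * (y + 2 * x) powr (- (p + 1)) \<partial>gamma_measure a) = - p * gamma_resolvent a (p + 1) y"
      by (simp add: gamma_resolvent_def)
    finally have "(\<lambda>i. \<integral>x. q (i + i0) x \<partial>gamma_measure a) \<longlonglongrightarrow> - p * gamma_resolvent a (p + 1) y" .
    moreover have "(\<integral>x. q (i + i0) x \<partial>gamma_measure a)
        = (gamma_resolvent a p (X (i + i0)) - gamma_resolvent a p y) / (X (i + i0) - y)" for i
      using i0[of "i + i0"] y unfolding q_def gamma_resolvent_def
      by (simp add: Bochner_Integration.integral_diff integrable_gamma_measure_powr a p)
    ultimately show "(\<lambda>i. (gamma_resolvent a p (X i) - gamma_resolvent a p y) / (X i - y))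
        \<longlonglongrightarrow> - p * gamma_resolvent a (p + 1) y"
      by (simp add: LIMSEQ_offset[of _ i0])
  qed
  then show ?thesis by (simp add: has_field_derivative_iff)
qed

text \<open>Multiplied by the gamma density, the integrand is \<open>1 / \<Gamma>(a)\<close> times the derivative of
  \<open>x\<^sup>a e\<^sup>-\<^sup>x (y + 2 x)\<^sup>-\<^sup>p\<close>.\<close>

lemma gamma_stein:
  assumes a: "a > 0" and y: "y > 0" and p: "p \<ge> 1"
  shows "(\<integral>x. (a - x) * (y + 2 * x) powr (- p) - 2 * p * x * (y + 2 * x) powr (- p - 1) \<partial>gamma_measure a) = 0"
    (is "(\<integral>x. ?k x \<partial>_) = 0")
proof -
  define H where "H x = x powr a * exp (- x) * (y + 2 * x) powr (- p)" for x
  define h where "h x = x powr (a - 1) * exp (- x) * ?k x" for x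
  have G: "Gamma a > 0" using a by (rule Gamma_real_pos)
  have deriv: "(H has_real_derivative h x) (at x)" if "x > 0" for x
  proof -
    have "(H has_real_derivative a * x powr (a - 1) * exp (- x) * (y + 2 * x) powr (- p)
        + x powr a * (- exp (- x)) * (y + 2 * x) powr (- p)
        + x powr a * exp (- x) * (- p * (y + 2 * x) powr (- p - 1) * 2)) (at x)"
      unfolding H_def using that y
      by (auto intro!: derivative_eq_intros simp: add_pos_pos algebra_simps)
    moreover have "x powr a = x * x powr (a - 1)"
      using that by (simp add: powr_mult_base)
    ultimately show ?thesis by (simp add: h_def algebra_simps)
  qed
  have gh: "gamma_density a x * ?k x = indicator {0<..} x * (h x / Gamma a)" for x
    by (auto simp: gamma_density_def h_def)
  have kint: "integrable (gamma_measure a) ?k"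
  proof -
    have i: "integrable (gamma_measure a) (\<lambda>x. (y + 2 * x) powr (- q))" if "q \<ge> 0" for q
      using that a y by (rule_tac integrable_gamma_measure_powr)
    \<comment> \<open>Substituting x = (Z - y)/2 with Z = y + 2 x removes the factor x:
      \<open>?k\<close> becomes a combination of Z^(-q) with q = p - 1, p, p + 1. Since p >= 1, all
      three powers are bounded.\<close>
    have "integrable (gamma_measure a) (\<lambda>x. a * (y + 2 * x) powr (- p)
        - ((y + 2 * x) powr (- (p - 1)) - y * (y + 2 * x) powr (- p)) / 2
        - p * ((y + 2 * x) powr (- p) - y * (y + 2 * x) powr (- (p + 1))))"
      using i[of p] i[of "p - 1"] i[of "p + 1"] p by simp
    then show ?thesis
    proof (rule Bochner_Integration.integrable_cong_AE_imp)
      show "AE x in gamma_measure a. a * (y + 2 * x) powr (- p)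
        - ((y + 2 * x) powr (- (p - 1)) - y * (y + 2 * x) powr (- p)) / 2
        - p * ((y + 2 * x) powr (- p) - y * (y + 2 * x) powr (- (p + 1))) = ?k x"
        using AE_gamma_measure_pos[of a]
      proof eventually_elim
        fix x :: real assume "x > 0"
        define Z where "Z = y + 2 * x"
        define e where "e = Z powr (- (p + 1))"
        have Z: "Z > 0" using \<open>x > 0\<close> y by (simp add: Z_def)
        have "Z powr (- (p + 1) + 1) = e * Z powr 1" "Z powr (- (p + 1) + 2) = e * Z powr 2"
          unfolding e_def by (rule powr_add)+
        then have e: "Z powr (- p) = Z * e" "Z powr (- (p - 1)) = Z^2 * e" "Z powr (- p - 1) = e"
          using Z by (simp_all add: e_def mult.commute diff_diff_eq2 uminus_add_conv_diff minus_diff_commute)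
        show "a * (y + 2 * x) powr (- p)
          - ((y + 2 * x) powr (- (p - 1)) - y * (y + 2 * x) powr (- p)) / 2
          - p * ((y + 2 * x) powr (- p) - y * (y + 2 * x) powr (- (p + 1))) = ?k x"
          unfolding Z_def[symmetric] e e_def[symmetric]
          by (simp add: Z_def field_simps power2_eq_square)
      qed
    qed measurable
  qed
  then have "integrable lborel (\<lambda>x. gamma_density a x * ?k x)"
    unfolding gamma_measure_def using a gamma_density_nonneg
    by (subst (asm) integrable_density) auto
  then have "integrable lborel (\<lambda>x. Gamma a * (gamma_density a x * ?k x))"
    by (rule integrable_mult_right)
  then have hint: "set_integrable lborel (einterval 0 \<infinity>) h"
    unfolding set_integrable_def gh using G by (simp add: einterval_def zero_ereal_def greaterThan_def)
  have "(LBINT x=0..\<infinity>. h x) = 0 - 0"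
  \<comment> \<open>The boundary terms of \<open>H\<close> vanish: at 0 because of x^a with a > 0,
    at infinity because of e^(-x).\<close>
  proof (rule interval_integral_FTC_integrable[where F = H])
    fix x :: real assume "0 < ereal x"
    then have "x > 0" by (simp add: zero_ereal_def)
    then show "(H has_vector_derivative h x) (at x)"
      using deriv has_real_derivative_iff_has_vector_derivative by blast
    show "isCont h x"
      unfolding h_def using \<open>x > 0\<close> y by (auto intro!: continuous_intros)
  next
    have "(H \<longlongrightarrow> 0) (at_right 0)"
    proof -
      have "((\<lambda>x. x powr a * exp (- x) * (y + 2 * x) powr (- p)) \<longlongrightarrow> 0 powr a * exp (- 0) * (y + 2 * 0) powr (- p)) (at_right 0)"
        using a y by (intro tendsto_intros) (auto simp: eventually_at_filter)
      then show ?thesis by (simp add: H_def[abs_def])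
    qed
    then show "((H \<circ> real_of_ereal) \<longlongrightarrow> 0) (at_right 0)"
      by (simp add: ereal_tendsto_simps zero_ereal_def)
    have "(H \<longlongrightarrow> 0) at_top"
    proof (rule tendsto_sandwich[where f = "\<lambda>_. 0" and h = "\<lambda>x. x powr a * exp (- x) * y powr (- p)"])
      show "((\<lambda>x. x powr a * exp (- x) * y powr (- p)) \<longlongrightarrow> 0) at_top"
        using a by real_asymp
      show "\<forall>\<^sub>F x in at_top. H x \<le> x powr a * exp (- x) * y powr (- p)"
        using eventually_gt_at_top[of 0]
        by eventually_elim (use y p in \<open>auto simp: H_def intro!: mult_left_mono powr_mono2'\<close>)
    qed (auto simp: H_def)
    then show "((H \<circ> real_of_ereal) \<longlongrightarrow> 0) (at_left \<infinity>)"
      by (simp add: ereal_tendsto_simps)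
  qed (use hint in auto)
  then have "(LBINT x:{0<..}. h x) = 0"
    by (simp add: interval_lebesgue_integral_def einterval_def zero_ereal_def greaterThan_def)
  then have "(\<integral>x. indicator {0<..} x * (h x / Gamma a) \<partial>lborel) = 0"
    by (simp add: set_lebesgue_integral_def)
  then show ?thesis
    using a by (subst integral_gamma_measure) (simp_all add: gh)
qed

text \<open>Write \<phi> for the resolvent of order s, so that \<phi>' and \<phi>'' are multiples of
  those of order s + 1 and s + 2. Multiplied by s, the identity reads 2 y \<phi>'' + 2 (1 - \<nu>)
  \<phi>' = s \<phi> + y \<phi>', which is Kummer's equation in y/2. It is twice
  \<open>gamma_stein\<close> at p = s + 1.\<close>

lemma gamma_resolvent_ode:
  assumes \<nu>: "\<nu> > 0" and s: "s > 0" and y: "y > 0" and a: "a = \<nu> + s"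
  shows "2 * y * (s + 1) * gamma_resolvent a (s + 2) y - 2 * (1 - \<nu>) * gamma_resolvent a (s + 1) y
       = gamma_resolvent a s y - y * gamma_resolvent a (s + 1) y"
proof -
  let ?m = "gamma_measure a"
  have i: "integrable ?m (\<lambda>x. (y + 2 * x) powr (- p))" if "p \<ge> 0" for p
    using integrable_gamma_measure_powr[of a y p] assms that by simp
  have "2 * y * (s + 1) * gamma_resolvent a (s + 2) y - 2 * (1 - \<nu>) * gamma_resolvent a (s + 1) y
       - (gamma_resolvent a s y - y * gamma_resolvent a (s + 1) y)
      = (\<integral>x. 2 * y * (s + 1) * (y + 2 * x) powr (- (s + 2)) - 2 * (1 - \<nu>) * (y + 2 * x) powr (- (s + 1))
       - ((y + 2 * x) powr (- s) - y * (y + 2 * x) powr (- (s + 1))) \<partial>?m)"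
    unfolding gamma_resolvent_def using i[of s] i[of "s+1"] i[of "s+2"] s
    by (simp add: Bochner_Integration.integral_diff)
  also have "\<dots> = (\<integral>x. 2 * ((a - x) * (y + 2 * x) powr (- (s + 1)) - 2 * (s + 1) * x * (y + 2 * x) powr (- (s + 1) - 1)) \<partial>?m)"
  proof (intro integral_cong_AE)
    show "AE x in ?m. 2 * y * (s + 1) * (y + 2 * x) powr (- (s + 2)) - 2 * (1 - \<nu>) * (y + 2 * x) powr (- (s + 1))
       - ((y + 2 * x) powr (- s) - y * (y + 2 * x) powr (- (s + 1)))
      = 2 * ((a - x) * (y + 2 * x) powr (- (s + 1)) - 2 * (s + 1) * x * (y + 2 * x) powr (- (s + 1) - 1))"
      using AE_gamma_measure_pos[of a]
    proof eventually_elim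
      fix x :: real assume "x > 0"
      define Z where "Z = y + 2 * x"
      \<comment> \<open>With the lowest power \<open>e\<close> factored out, a polynomial identity
        in x and y remains. The coefficients of Z agree exactly when a = \<nu> + s, which is why
        this gamma parameter appears.\<close>
      define e where "e = Z powr (- (s + 2))"
      have Z: "Z > 0" using \<open>x > 0\<close> y by (simp add: Z_def)
      have "Z powr (- (s + 2) + 1) = e * Z powr 1" "Z powr (- (s + 2) + 2) = e * Z powr 2"
        unfolding e_def by (rule powr_add)+
      then have e: "Z powr (- (s + 1)) = Z * e" "Z powr (- s) = Z^2 * e" "Z powr (- (s + 1) - 1) = e"
        using Z by (simp_all add: e_def mult.commute algebra_simps)
      show "2 * y * (s + 1) * (y + 2 * x) powr (- (s + 2)) - 2 * (1 - \<nu>) * (y + 2 * x) powr (- (s + 1))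
       - ((y + 2 * x) powr (- s) - y * (y + 2 * x) powr (- (s + 1)))
      = 2 * ((a - x) * (y + 2 * x) powr (- (s + 1)) - 2 * (s + 1) * x * (y + 2 * x) powr (- (s + 1) - 1))"
        unfolding Z_def[symmetric] e e_def[symmetric] a
        by (simp add: Z_def algebra_simps power2_eq_square)
    qed
  qed measurable
  also have "\<dots> = 0"
    using gamma_stein[of a y "s + 1"] assms
    by (subst Bochner_Integration.integral_mult_right_zero) simp_all
  finally show ?thesis by simp
qed

section \<open>A space-time harmonic function\<close>

lemma powr_eq_power_mult_powr: "x > 0 \<Longrightarrow> p = q + real n \<Longrightarrow> x powr p = x ^ n * x powr q" for x :: real
  by (simp add: powr_add powr_realpow)

text \<open>\<open>scaled_resolvent a p B q = E[(q + 2 B \<gamma>\<^sub>a)\<^sup>-\<^sup>p]\<close> for \<open>B, q > 0\<close>.\<close>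

definition scaled_resolvent :: "real \<Rightarrow> real \<Rightarrow> real \<Rightarrow> real \<Rightarrow> real" where
  "scaled_resolvent a p B q = B powr (- p) * gamma_resolvent a p (q / B)"

lemma scaled_resolvent_nonneg: "0 \<le> scaled_resolvent a p B q"
  by (simp add: scaled_resolvent_def gamma_resolvent_nonneg)

lemma scaled_resolvent_le:
  assumes "a > 0" "p \<ge> 0" "B > 0" "q > 0"
  shows "scaled_resolvent a p B q \<le> q powr (- p)"
proof -
  have "scaled_resolvent a p B q \<le> B powr (- p) * (q / B) powr (- p)"
    unfolding scaled_resolvent_def using assms by (intro mult_left_mono gamma_resolvent_le) auto
  also have "\<dots> = q powr (- p)"
    using assms by (simp add: powr_mult[symmetric])
  finally show ?thesis .
qed

lemma scaled_resolvent_has_real_derivative: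
  assumes "a > 0" "p \<ge> 0" "B > 0" "q > 0"
  shows "(scaled_resolvent a p B has_real_derivative - p * scaled_resolvent a (p + 1) B q) (at q)"
proof -
  have "((\<lambda>q. gamma_resolvent a p (q / B)) has_real_derivative
      - p * gamma_resolvent a (p + 1) (q / B) * (1 / B)) (at q)"
    by (rule DERIV_chain2[OF gamma_resolvent_has_real_derivative])
      (use assms in \<open>auto intro!: derivative_eq_intros\<close>)
  from DERIV_cmult[OF this, of "B powr (- p)"]
  have "(scaled_resolvent a p B has_real_derivative
      B powr (- p) * (- p * gamma_resolvent a (p + 1) (q / B) * (1 / B))) (at q)"
    by (simp add: scaled_resolvent_def[abs_def])
  moreover have "B powr (- (p + 1)) = B powr (- p) / B"
    using assms powr_diff[of B "- p" 1] by simp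
  ultimately show ?thesis
    unfolding scaled_resolvent_def by (simp add: mult_ac)
qed

lemma scaled_resolvent_scale_derivative:
  assumes "a > 0" "p \<ge> 0" "B > 0" "q > 0"
  shows "((\<lambda>B. scaled_resolvent a p B q) has_real_derivative
      - (p / B * (scaled_resolvent a p B q - q * scaled_resolvent a (p + 1) B q))) (at B)"
proof -
  have "((\<lambda>B. gamma_resolvent a p (q / B)) has_real_derivative
      - p * gamma_resolvent a (p + 1) (q / B) * (- q / B\<^sup>2)) (at B)"
    by (rule DERIV_chain2[OF gamma_resolvent_has_real_derivative])
      (use assms in \<open>auto intro!: derivative_eq_intros simp: power2_eq_square\<close>)
  from DERIV_mult[OF has_real_derivative_powr[of B "- p"] this] assms
  have "((\<lambda>B. scaled_resolvent a p B q) has_real_derivative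
      - p * B powr (- p - 1) * gamma_resolvent a p (q / B)
      + - p * gamma_resolvent a (p + 1) (q / B) * (- q / B\<^sup>2) * B powr (- p)) (at B)"
    by (simp add: scaled_resolvent_def)
  moreover have "- p * B powr (- p - 1) * gamma_resolvent a p (q / B)
      + - p * gamma_resolvent a (p + 1) (q / B) * (- q / B\<^sup>2) * B powr (- p)
    = - (p / B * (scaled_resolvent a p B q - q * scaled_resolvent a (p + 1) B q))"
  proof -
    define k where "k = B powr (- p - 1)"
    have e: "B powr (- p) = B * k" "B powr (- (p + 1)) = k"
      using assms powr_eq_power_mult_powr[of B "- p" "- p - 1" 1] by (simp_all add: k_def)
    show ?thesis
      unfolding scaled_resolvent_def e k_def[symmetric] using assms
      by (simp add: field_simps power2_eq_square)
  qed
  ultimately show ?thesis by (rule DERIV_cong)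
qed

text \<open>Put q = x^2 and multiply by s: the left side is the Bessel generator applied to x
  \<mapsto> \<open>scaled_resolvent a s B (x\<^sup>2)\<close>, and the right side is minus the
  derivative in B. So this is space-time harmonicity, with B in the role of b + t. It is
  \<open>gamma_resolvent_ode\<close> at y = q/B, rescaled.\<close>

lemma scaled_resolvent_ode:
  assumes "\<nu> > 0" "s > 0" "B > 0" "q > 0" "a = \<nu> + s"
  shows "2 * (s + 1) * q * scaled_resolvent a (s + 2) B q - 2 * (1 - \<nu>) * scaled_resolvent a (s + 1) B q
       = (scaled_resolvent a s B q - q * scaled_resolvent a (s + 1) B q) / B"
proof -
  have e: "B powr (- s) = B^2 * B powr (- (s + 2))" "B powr (- (s + 1)) = B * B powr (- (s + 2))"
    using assms powr_eq_power_mult_powr[of B "- s" "- (s + 2)" 2]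
      powr_eq_power_mult_powr[of B "- (s + 1)" "- (s + 2)" 1] by simp_all
  have "B * B powr (- (s + 2)) * (2 * (q / B) * (s + 1) * gamma_resolvent a (s + 2) (q / B) - 2 * (1 - \<nu>) * gamma_resolvent a (s + 1) (q / B))
       = B * B powr (- (s + 2)) * (gamma_resolvent a s (q / B) - (q / B) * gamma_resolvent a (s + 1) (q / B))"
    using assms by (subst gamma_resolvent_ode) auto
  then show ?thesis
    unfolding scaled_resolvent_def e using assms
    by (simp add: field_simps power2_eq_square)
qed

lemma continuous_on_scaled_resolvent:
  assumes "a > 0" "p \<ge> 0" "continuous_on S f" "continuous_on S g"
    "\<And>x. x \<in> S \<Longrightarrow> f x > 0" "\<And>x. x \<in> S \<Longrightarrow> g x > 0"
  shows "continuous_on S (\<lambda>x. scaled_resolvent a p (f x) (g x))"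
proof -
  have "continuous_on {0<..} (gamma_resolvent a p)"
    by (intro continuous_at_imp_continuous_on ballI DERIV_isCont)
      (use assms gamma_resolvent_has_real_derivative in auto)
  then have "continuous_on S (\<lambda>x. gamma_resolvent a p (g x / f x))"
    by (rule continuous_on_compose2)
      (use assms in \<open>force intro!: continuous_intros\<close>)+
  then show ?thesis
    unfolding scaled_resolvent_def
    by (intro continuous_intros) (use assms in force)+
qed

section \<open>Bounded C^2 test functions extending the harmonic function below \<epsilon>\<close>

lemma has_real_derivative_max_power:
  "((\<lambda>x::real. max 0 x ^ Suc (Suc n)) has_real_derivative real (n + 2) * max 0 x ^ Suc n) (at x)"
proof -
  consider "x < 0" | "x = 0" | "x > 0" by linarith
  then show ?thesis
  proof cases
    case 1
    have "((\<lambda>_. 0) has_real_derivative 0) (at x)" by simp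
    then have "((\<lambda>x::real. max 0 x ^ Suc (Suc n)) has_real_derivative 0) (at x)"
      by (rule has_field_derivative_transform_within_open[where S = "{..<0}"]) (use 1 in auto)
    then show ?thesis using 1 by simp
  next
    case 3
    have "((\<lambda>x. x ^ Suc (Suc n)) has_real_derivative real (n + 2) * x ^ Suc n) (at x)"
      using DERIV_pow[of "Suc (Suc n)" x UNIV] by simp
    then have "((\<lambda>x::real. max 0 x ^ Suc (Suc n)) has_real_derivative real (n + 2) * x ^ Suc n) (at x)"
      by (rule has_field_derivative_transform_within_open[where S = "{0<..}"]) (use 3 in auto)
    then show ?thesis using 3 by simp
  next
    case 2
    \<comment> \<open>At the kink the difference quotient is the next lower power of the positive
      part, whose exponent is still at least 1.\<close>
    have "((\<lambda>y::real. max 0 y ^ Suc n) \<longlongrightarrow> max 0 0 ^ Suc n) (at 0)"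
      by (intro tendsto_intros)
    moreover have "\<forall>\<^sub>F y::real in at 0. max 0 y ^ Suc n = max 0 y ^ Suc (Suc n) / y"
      by (auto simp: eventually_at_filter max_def)
    ultimately have "((\<lambda>y::real. max 0 y ^ Suc (Suc n) / y) \<longlongrightarrow> max 0 0 ^ Suc n) (at 0)"
      by (rule Lim_transform_eventually)
    then show ?thesis using 2 by (simp add: has_field_derivative_iff)
  qed
qed

text \<open>A \<open>C\<^sup>2\<close> function that is \<open>x\<^sup>2\<close> on \<open>[\<epsilon>, \<infinity>)\<close> and stays away from 0.\<close>

definition smooth_square :: "real \<Rightarrow> real \<Rightarrow> real" where
  "smooth_square \<epsilon> x = x\<^sup>2 + 2 / \<epsilon> * max 0 (\<epsilon> - x) ^ 3"

definition smooth_square' :: "real \<Rightarrow> real \<Rightarrow> real" where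
  "smooth_square' \<epsilon> x = 2 * x - 6 / \<epsilon> * max 0 (\<epsilon> - x) ^ 2"

definition smooth_square'' :: "real \<Rightarrow> real \<Rightarrow> real" where
  "smooth_square'' \<epsilon> x = 2 + 12 / \<epsilon> * max 0 (\<epsilon> - x)"

lemma smooth_square_derivs:
  "(smooth_square \<epsilon> has_real_derivative smooth_square' \<epsilon> x) (at x)"
  "(smooth_square' \<epsilon> has_real_derivative smooth_square'' \<epsilon> x) (at x)"
proof -
  have d: "((\<lambda>x::real. max 0 (\<epsilon> - x) ^ Suc (Suc n)) has_real_derivative real (n + 2) * max 0 (\<epsilon> - x) ^ Suc n * (- 1)) (at x)" for n
    by (rule DERIV_chain2[OF has_real_derivative_max_power]) (auto intro!: derivative_eq_intros)
  have d3: "((\<lambda>x. max 0 (\<epsilon> - x) ^ 3) has_real_derivative 3 * max 0 (\<epsilon> - x) ^ 2 * (- 1)) (at x)"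
    and d2: "((\<lambda>x. max 0 (\<epsilon> - x) ^ 2) has_real_derivative 2 * max 0 (\<epsilon> - x) * (- 1)) (at x)"
    using d[of 1] d[of 0] by (simp_all add: numeral_3_eq_3 numeral_2_eq_2)
  have q: "((\<lambda>x. x\<^sup>2) has_real_derivative 2 * x) (at x)" "((\<lambda>x. 2 * x) has_real_derivative 2) (at x)"
    by (auto intro!: derivative_eq_intros)
  show "(smooth_square \<epsilon> has_real_derivative smooth_square' \<epsilon> x) (at x)"
    unfolding smooth_square_def[abs_def] smooth_square'_def
    by (rule DERIV_cong[OF DERIV_add[OF q(1) DERIV_cmult[OF d3]]]) simp
  show "(smooth_square' \<epsilon> has_real_derivative smooth_square'' \<epsilon> x) (at x)"
    unfolding smooth_square'_def[abs_def] smooth_square''_def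
    by (rule DERIV_cong[OF DERIV_diff[OF q(2) DERIV_cmult[OF d2]]]) simp
qed

text \<open>From \<epsilon>/2 on the square alone suffices. Below \<epsilon>/2 the cubic term is at
  least (2/\<epsilon>) (\<epsilon>/2)^3 = \<epsilon>^2/4, which explains the coefficient
  2/\<epsilon> in the definition.\<close>

lemma smooth_square_ge:
  assumes "\<epsilon> > 0"
  shows "\<epsilon>\<^sup>2 / 4 \<le> smooth_square \<epsilon> x"
proof (cases "x \<ge> \<epsilon> / 2")
  case True
  then have "(\<epsilon> / 2)\<^sup>2 \<le> x\<^sup>2" using assms by (intro power_mono) auto
  then show ?thesis using assms by (simp add: smooth_square_def power_divide add_increasing2)
next
  case False
  then have "\<epsilon> / 2 \<le> max 0 (\<epsilon> - x)" by (simp add: max_def)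
  then have "(\<epsilon> / 2) ^ 3 \<le> max 0 (\<epsilon> - x) ^ 3"
    by (rule power_mono) (use assms in simp)
  then have "2 / \<epsilon> * (\<epsilon> / 2) ^ 3 \<le> 2 / \<epsilon> * max 0 (\<epsilon> - x) ^ 3"
    by (rule mult_left_mono) (use assms in simp)
  also have "2 / \<epsilon> * (\<epsilon> / 2) ^ 3 = \<epsilon>\<^sup>2 / 4"
    using assms by (simp add: field_simps eval_nat_numeral)
  finally show ?thesis by (simp add: smooth_square_def add_increasing)
qed

text \<open>The first bound makes z' of order sqrt z, so that negative powers of z can absorb its
  growth. For x > 0 the number p = max 0 (\<epsilon> - x) is at most \<epsilon>, whence (z')^2 <= 8
  x^2 + 72 p^3/\<epsilon>. As z contains 2 p^3/\<epsilon>, the factor 44 covers both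
  coefficients.\<close>

lemma smooth_square_deriv_bounds:
  assumes "\<epsilon> > 0" "x > 0"
  shows "(smooth_square' \<epsilon> x)\<^sup>2 \<le> 44 * smooth_square \<epsilon> x" "\<bar>smooth_square'' \<epsilon> x\<bar> \<le> 14"
proof -
  define p where "p = max 0 (\<epsilon> - x)"
  have p: "0 \<le> p" "p \<le> \<epsilon>" using assms by (auto simp: p_def)
  have "(2 * x - 6 / \<epsilon> * p\<^sup>2)\<^sup>2 \<le> 2 * (2 * x)\<^sup>2 + 2 * (6 / \<epsilon> * p\<^sup>2)\<^sup>2"
    using sum_squares_bound[of "2 * x" "- (6 / \<epsilon> * p\<^sup>2)"]
    by (simp add: power2_diff)
  also have "(6 / \<epsilon> * p\<^sup>2)\<^sup>2 = 36 / \<epsilon> * p ^ 3 * (p / \<epsilon>)"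
    using assms by (simp add: power2_eq_square eval_nat_numeral)
  also have "\<dots> \<le> 36 / \<epsilon> * p ^ 3 * 1"
    using p assms by (intro mult_left_mono) auto
  finally have "(2 * x - 6 / \<epsilon> * p\<^sup>2)\<^sup>2 \<le> 8 * x\<^sup>2 + 72 * (p ^ 3 / \<epsilon>)" by simp
  also have "\<dots> \<le> 44 * x\<^sup>2 + 88 * (p ^ 3 / \<epsilon>)"
    using p assms by (intro add_mono mult_right_mono) auto
  finally show "(smooth_square' \<epsilon> x)\<^sup>2 \<le> 44 * smooth_square \<epsilon> x"
    by (simp add: smooth_square_def smooth_square'_def p_def)
  have "12 / \<epsilon> * p \<le> 12 / \<epsilon> * \<epsilon>" using p assms by (intro mult_left_mono) auto
  then show "\<bar>smooth_square'' \<epsilon> x\<bar> \<le> 14"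
    using p assms by (simp add: smooth_square''_def p_def[symmetric])
qed

text \<open>The martingale problem takes only test functions that are bounded with two derivatives
  on the whole half-line, while negative powers of x^2 blow up at 0. Replacing x^2 by z =
  \<open>smooth_square \<epsilon> x\<close> repairs this and leaves the generator unchanged for x >=
  \<epsilon>. The bounds combine z >= \<epsilon>^2/4, the estimate z^(-p) for the resolvent of order
  p, and z' = O(sqrt z).\<close>

lemma C2_bounded_scaled_resolvent:
  assumes "a > 0" "s > 0" "B > 0" "\<epsilon> > 0"
  defines "f \<equiv> (\<lambda>x. scaled_resolvent a s B (smooth_square \<epsilon> x))"
  shows "C2_bounded f"
    and "a = \<nu> + s \<Longrightarrow> \<nu> > 0 \<Longrightarrow> x \<ge> \<epsilon> \<Longrightarrow> bessel_generator \<nu> f x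
      = s / B * (scaled_resolvent a s B (x\<^sup>2) - x\<^sup>2 * scaled_resolvent a (s + 1) B (x\<^sup>2))"
proof -
  define z z' z'' where zs: "z = smooth_square \<epsilon>" "z' = smooth_square' \<epsilon>" "z'' = smooth_square'' \<epsilon>"
  define f' where "f' x = - s * scaled_resolvent a (s + 1) B (z x) * z' x" for x
  define f'' where "f'' x = s * (s + 1) * scaled_resolvent a (s + 2) B (z x) * (z' x)\<^sup>2
      - s * scaled_resolvent a (s + 1) B (z x) * z'' x" for x
  have z0: "0 < \<epsilon>\<^sup>2 / 4" and z_ge: "\<epsilon>\<^sup>2 / 4 \<le> z x" for x
    using assms smooth_square_ge by (auto simp: zs)
  then have z_pos: "z x > 0" for x by (meson less_le_trans)
  have dz: "(z has_real_derivative z' x) (at x)" "(z' has_real_derivative z'' x) (at x)" for x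
    unfolding zs by (rule smooth_square_derivs)+
  have dS: "((\<lambda>x. scaled_resolvent a p B (z x)) has_real_derivative
      - p * scaled_resolvent a (p + 1) B (z x) * z' x) (at x)" if "p \<ge> 0" for p x
    by (rule DERIV_chain2[OF scaled_resolvent_has_real_derivative dz(1)]) (use assms that z_pos in auto)
  have df: "(f has_real_derivative f' x) (at x)" for x
    unfolding f_def f'_def zs(1)[symmetric] using dS[of s] assms by simp
  have df': "(f' has_real_derivative f'' x) (at x)" for x
    unfolding f'_def[abs_def] f''_def
  proof (rule DERIV_cong)
    have "((\<lambda>x. scaled_resolvent a (s + 1) B (z x)) has_real_derivative
        - (s + 1) * scaled_resolvent a (s + 2) B (z x) * z' x) (at x)"
      using dS[of "s + 1" x] assms by (simp add: add.assoc)
    from DERIV_mult[OF DERIV_cmult[OF this, of "- s"] dz(2)]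
    show "((\<lambda>x. - s * scaled_resolvent a (s + 1) B (z x) * z' x) has_real_derivative
        - s * (- (s + 1) * scaled_resolvent a (s + 2) B (z x) * z' x) * z' x
        + z'' x * (- s * scaled_resolvent a (s + 1) B (z x))) (at x)" .
  qed (simp add: algebra_simps power2_eq_square)
  have deriv_f: "deriv f = f'" and deriv_f': "deriv f' = f''"
    using df df' by (auto intro: DERIV_imp_deriv)
  have S_le: "scaled_resolvent a p B (z x) \<le> z x powr (- p)" if "p \<ge> 0" for p x
    by (rule scaled_resolvent_le) (use assms that z_pos in auto)
  have powr_le: "z x powr (- p) \<le> (\<epsilon>\<^sup>2 / 4) powr (- p)" if "p \<ge> 0" for p x
    by (rule powr_mono2') (use z0 z_ge that in auto)
  show "C2_bounded f"
    unfolding C2_bounded_def deriv_f deriv_f'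
  proof (intro conjI allI impI)
    show "f differentiable at x" "f' differentiable at x" for x
      using df df' real_differentiable_def by blast+
    have cz: "continuous_on UNIV z" "continuous_on UNIV z'"
      by (auto intro!: continuous_at_imp_continuous_on DERIV_isCont dz)
    have "continuous_on UNIV z''"
      unfolding zs smooth_square''_def[abs_def] by (intro continuous_intros)
    then have "continuous_on UNIV f''"
      unfolding f''_def[abs_def]
      by (intro continuous_intros cz continuous_on_scaled_resolvent) (use assms z_pos in auto)
    then show "continuous_on {0<..} f''" by (rule continuous_on_subset) simp
    show "bounded (f ` {0<..})"
    proof (rule boundedI)
      fix y assume "y \<in> f ` {0<..}"
      then obtain x where "y = f x" by auto
      then show "norm y \<le> (\<epsilon>\<^sup>2 / 4) powr (- s)"
        using S_le[of s x] powr_le[of s x] assms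
        by (simp add: f_def zs scaled_resolvent_nonneg)
    qed
    show "bounded (f' ` {0<..})"
    proof (rule boundedI)
      fix y assume "y \<in> f' ` {0<..}"
      then obtain x where y: "y = f' x" "x > 0" by auto
      have "\<bar>z' x\<bar> \<le> sqrt (44 * z x)"
        using smooth_square_deriv_bounds(1)[of \<epsilon> x] y assms real_le_rsqrt[of "\<bar>z' x\<bar>" "44 * z x"]
        by (simp add: zs)
      then have "norm y \<le> s * z x powr (- (s + 1)) * sqrt (44 * z x)"
        using S_le[of "s + 1" x] assms unfolding y f'_def
        by (auto simp: abs_mult scaled_resolvent_nonneg intro!: mult_mono)
      also have "\<dots> = s * sqrt 44 * z x powr (- (s + 1) + 1 / 2)"
        using z_pos[of x] unfolding powr_add
        by (simp add: real_sqrt_mult powr_half_sqrt)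
      also have "- (s + 1) + 1 / 2 = - (s + 1 / 2)"
        by simp
      also have "s * sqrt 44 * z x powr (- (s + 1 / 2)) \<le> s * sqrt 44 * (\<epsilon>\<^sup>2 / 4) powr (- (s + 1 / 2))"
        by (intro mult_left_mono powr_le) (use assms in auto)
      finally show "norm y \<le> s * sqrt 44 * (\<epsilon>\<^sup>2 / 4) powr (- (s + 1 / 2))" .
    qed
    show "bounded (f'' ` {0<..})"
    proof (rule boundedI)
      fix y assume "y \<in> f'' ` {0<..}"
      then obtain x where y: "y = f'' x" "x > 0" by auto
      have "norm y \<le> s * (s + 1) * scaled_resolvent a (s + 2) B (z x) * (z' x)\<^sup>2
          + s * scaled_resolvent a (s + 1) B (z x) * \<bar>z'' x\<bar>"
        using assms unfolding y f''_def
        by (intro order_trans[OF norm_triangle_ineq4])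
          (auto simp: abs_mult scaled_resolvent_nonneg)
      also have "\<dots> \<le> s * (s + 1) * z x powr (- (s + 2)) * (44 * z x) + s * z x powr (- (s + 1)) * 14"
        using S_le[of "s + 1" x] S_le[of "s + 2" x] smooth_square_deriv_bounds[of \<epsilon> x] assms y
        by (intro add_mono mult_mono) (auto simp: zs scaled_resolvent_nonneg)
      also have "\<dots> = (44 * s * (s + 1) + 14 * s) * z x powr (- (s + 1))"
        using powr_add[of "z x" "- (s + 2)" 1] z_pos[of x] by (simp add: algebra_simps)
      also have "\<dots> \<le> (44 * s * (s + 1) + 14 * s) * (\<epsilon>\<^sup>2 / 4) powr (- (s + 1))"
        by (intro mult_left_mono powr_le) (use assms in auto)
      finally show "norm y \<le> (44 * s * (s + 1) + 14 * s) * (\<epsilon>\<^sup>2 / 4) powr (- (s + 1))" .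
    qed
  qed
  assume a: "a = \<nu> + s" "\<nu> > 0" and x: "x \<ge> \<epsilon>"
  have zx: "z x = x\<^sup>2" "z' x = 2 * x" "z'' x = 2" and "x > 0"
    using x assms by (auto simp: zs smooth_square_def smooth_square'_def smooth_square''_def)
  have "bessel_generator \<nu> f x = s * (2 * (s + 1) * x\<^sup>2 * scaled_resolvent a (s + 2) B (x\<^sup>2)
      - 2 * (1 - \<nu>) * scaled_resolvent a (s + 1) B (x\<^sup>2))"
    unfolding bessel_generator_def deriv_f deriv_f' f'_def f''_def zx using \<open>x > 0\<close>
    by (simp add: field_simps power2_eq_square)
  also have "\<dots> = s * ((scaled_resolvent a s B (x\<^sup>2) - x\<^sup>2 * scaled_resolvent a (s + 1) B (x\<^sup>2)) / B)"
    by (subst scaled_resolvent_ode) (use assms a \<open>x > 0\<close> in auto)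
  finally show "bessel_generator \<nu> f x
      = s / B * (scaled_resolvent a s B (x\<^sup>2) - x\<^sup>2 * scaled_resolvent a (s + 1) B (x\<^sup>2))" by simp
qed

section \<open>First zeros of continuous paths\<close>

lemma tendsto_ceiling_fraction:
  assumes "v \<ge> 0"
  shows "(\<lambda>n. real (nat \<lceil>v * real (Suc n)\<rceil>) / real (Suc n)) \<longlonglongrightarrow> v"
proof (rule real_tendsto_sandwich[where f = "\<lambda>_. v" and h = "\<lambda>n. v + 1 / real (Suc n)"])
  show "(\<lambda>n. v + 1 / real (Suc n)) \<longlonglongrightarrow> v"
    using tendsto_add[OF tendsto_const[of v] lim_inverse_n'[THEN LIMSEQ_Suc]] by simp
  have "v * real (Suc n) \<le> real (nat \<lceil>v * real (Suc n)\<rceil>)" for n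
    by (rule real_nat_ceiling_ge)
  then show "\<forall>\<^sub>F n in sequentially. v \<le> real (nat \<lceil>v * real (Suc n)\<rceil>) / real (Suc n)"
    by (simp add: pos_le_divide_eq del: of_nat_Suc)
  have "real (nat \<lceil>v * real (Suc n)\<rceil>) \<le> v * real (Suc n) + 1" for n
    using of_int_ceiling_le_add_one[of "v * real (Suc n)"] assms by simp
  then show "\<forall>\<^sub>F n in sequentially. real (nat \<lceil>v * real (Suc n)\<rceil>) / real (Suc n) \<le> v + 1 / real (Suc n)"
    by (simp add: field_simps del: of_nat_Suc)
qed simp

text \<open>Hitting times and the crossing time are both first zeros of a path minus a moving level,
  so one deterministic notion serves both. The infimum of the empty set is \<infinity>.\<close>

definition zero_time :: "(real \<Rightarrow> real) \<Rightarrow> ereal" where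
  "zero_time h = Inf (ereal ` {u. 0 \<le> u \<and> h u = 0})"

lemma hitting_time_eq_zero_time: "hitting_time R y \<omega> = zero_time (\<lambda>u. R u \<omega> - y)"
  by (simp add: hitting_time_def zero_time_def)

lemma first_zero:
  fixes h :: "real \<Rightarrow> real"
  assumes "continuous_on {0..} h" "h 0 > 0" "v \<ge> 0" "h v \<le> 0"
  obtains w where "0 \<le> w" "w \<le> v" "h w = 0" "\<And>x. 0 \<le> x \<Longrightarrow> x < w \<Longrightarrow> h x > 0"
proof -
  have cont: "continuous_on {0..x} h" for x
    by (rule continuous_on_subset[OF assms(1)]) auto
  have vmem: "v \<in> {0..v} \<inter> h -` {..0}" using assms by auto
  have "closed ({0..v} \<inter> h -` {..0})"
    by (intro continuous_closed_preimage[OF cont]) auto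
  then have "compact ({0..v} \<inter> h -` {..0})"
    by (auto simp: compact_eq_bounded_closed intro: bounded_subset[of "{0..v}"])
  then obtain w where w: "w \<in> {0..v} \<inter> h -` {..0}" and min: "\<And>x. x \<in> {0..v} \<inter> h -` {..0} \<Longrightarrow> w \<le> x"
    using compact_attains_inf[of "{0..v} \<inter> h -` {..0}"] vmem by (metis emptyE)
  have pos: "h x > 0" if "0 \<le> x" "x < w" for x
    using min[of x] that w by force
  \<comment> \<open>So far only h w <= 0 is known. The intermediate value theorem gives a zero in
    [0, w], and minimality of w forces it to be w itself.\<close>
  obtain x where "0 \<le> x" "x \<le> w" "h x = 0"
    using IVT2'[of h w 0 0] w assms cont by auto
  with pos[of x] have "h w = 0" by force
  then show ?thesis using that w pos by auto
qed

lemma zero_time_cases: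
  assumes "continuous_on {0..} h" "h 0 > 0"
  obtains (never) "zero_time h = \<infinity>" "\<And>u. u \<ge> 0 \<Longrightarrow> h u > 0"
  | (at) w where "zero_time h = ereal w" "0 \<le> w" "h w = 0" "\<And>x. 0 \<le> x \<Longrightarrow> x < w \<Longrightarrow> h x > 0"
proof (cases "\<forall>u\<ge>0. h u > 0")
  case True
  then have "{u. 0 \<le> u \<and> h u = 0} = {}" by force
  then have "zero_time h = \<infinity>" unfolding zero_time_def by (simp only: image_empty Inf_empty top_ereal_def)
  with True never show ?thesis by blast
next
  case False
  then obtain v where "v \<ge> 0" "h v \<le> 0" by force
  with assms obtain w where w: "0 \<le> w" "h w = 0" "\<And>x. 0 \<le> x \<Longrightarrow> x < w \<Longrightarrow> h x > 0"
    by (meson first_zero)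
  have "zero_time h = ereal w"
    unfolding zero_time_def
  proof (rule Inf_eqI)
    fix i assume "i \<in> ereal ` {u. 0 \<le> u \<and> h u = 0}"
    then obtain u where "i = ereal u" "0 \<le> u" "h u = 0" by auto
    with w(3)[of u] show "ereal w \<le> i" by force
  next
    fix y assume "\<And>i. i \<in> ereal ` {u. 0 \<le> u \<and> h u = 0} \<Longrightarrow> y \<le> i"
    then show "y \<le> ereal w" using w by auto
  qed
  with w at show ?thesis by blast
qed

lemma less_zero_time_iff:
  assumes "continuous_on {0..} h" "h 0 > 0" "u \<ge> 0"
  shows "ereal u < zero_time h \<longleftrightarrow> (\<forall>v\<in>{0..u}. h v > 0)"
  using assms(1,2)
proof (cases rule: zero_time_cases)
  case never
  then show ?thesis by auto
next
  case (at w)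
  then show ?thesis using assms(3) by (force simp: not_less[symmetric])
qed

text \<open>Positivity on the compact interval [0, u] means a lower bound 1/(n + 1), and by
  continuity this bound need only be tested at countably many times. The sampling times are cut off
  at u, so the event depends on the path up to u only; this gives the stopping property without
  enlarging the filtration.\<close>

lemma sets_less_zero_time:
  fixes h :: "'a \<Rightarrow> real \<Rightarrow> real"
  assumes h: "\<And>\<omega>. \<omega> \<in> space F \<Longrightarrow> continuous_on {0..} (h \<omega>)" "\<And>\<omega>. \<omega> \<in> space F \<Longrightarrow> h \<omega> 0 > 0"
    and meas: "\<And>v. 0 \<le> v \<Longrightarrow> v \<le> u \<Longrightarrow> (\<lambda>\<omega>. h \<omega> v) \<in> borel_measurable F"
    and u: "u \<ge> 0"
  shows "{\<omega> \<in> space F. ereal u < zero_time (h \<omega>)} \<in> sets F"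
proof -
  define q where "q k m = min u (real k / real (Suc m))" for k m :: nat
  have q_mem: "q k m \<in> {0..u}" for k m using u by (auto simp: q_def)
  have [measurable]: "(\<lambda>\<omega>. h \<omega> (q k m)) \<in> borel_measurable F" for k m
    by (rule meas) (use q_mem in auto)
  have "{\<omega> \<in> space F. \<exists>n::nat. \<forall>k m. 1 / real (Suc n) \<le> h \<omega> (q k m)} \<in> sets F"
    by measurable
  moreover have "ereal u < zero_time (h \<omega>) \<longleftrightarrow> (\<exists>n::nat. \<forall>k m. 1 / real (Suc n) \<le> h \<omega> (q k m))"
    if \<omega>: "\<omega> \<in> space F" for \<omega>
    unfolding less_zero_time_iff[OF h[OF \<omega>] u]
  proof
    assume pos: "\<forall>v\<in>{0..u}. h \<omega> v > 0"
    have "continuous_on {0..u} (h \<omega>)" by (rule continuous_on_subset[OF h(1)[OF \<omega>]]) auto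
    then obtain w where w: "w \<in> {0..u}" "\<And>v. v \<in> {0..u} \<Longrightarrow> h \<omega> w \<le> h \<omega> v"
      using continuous_attains_inf[of "{0..u}" "h \<omega>"] u by auto
    obtain n where "1 / real (Suc n) < h \<omega> w"
      using reals_Archimedean[of "h \<omega> w"] pos w(1) by (auto simp: inverse_eq_divide)
    then show "\<exists>n::nat. \<forall>k m. 1 / real (Suc n) \<le> h \<omega> (q k m)"
      using w(2) q_mem by (meson less_eq_real_def order_trans)
  next
    assume "\<exists>n::nat. \<forall>k m. 1 / real (Suc n) \<le> h \<omega> (q k m)"
    then obtain n where n: "\<And>k m. 1 / real (Suc n) \<le> h \<omega> (q k m)" by auto
    show "\<forall>v\<in>{0..u}. h \<omega> v > 0"
    proof
      fix v assume v: "v \<in> {0..u}"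
      have "(\<lambda>m. q (nat \<lceil>v * real (Suc m)\<rceil>) m) \<longlonglongrightarrow> min u v"
        unfolding q_def by (intro tendsto_min tendsto_const tendsto_ceiling_fraction) (use v in auto)
      then have "(\<lambda>m. h \<omega> (q (nat \<lceil>v * real (Suc m)\<rceil>) m)) \<longlonglongrightarrow> h \<omega> v"
        using v q_mem by (intro continuous_on_tendsto_compose[OF h(1)[OF \<omega>]]) (auto simp: min_absorb2)
      then have "1 / real (Suc n) \<le> h \<omega> v"
        by (rule LIMSEQ_le_const) (use n in auto)
      then show "h \<omega> v > 0" by (meson less_le_trans of_nat_0_less_iff zero_less_Suc zero_less_divide_1_iff)
    qed
  qed
  ultimately show ?thesis by (simp cong: conj_cong)
qed

section \<open>The natural filtration and martingale increments over past events\<close>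

lemma space_natural_filtration [simp]: "space (natural_filtration M R t) = space M"
  by (simp add: natural_filtration_def space_measure_of_conv)

lemma natural_filtration_generators:
  "{R u -` B \<inter> space M | u B. 0 \<le> u \<and> u \<le> t \<and> B \<in> sets borel} \<subseteq> Pow (space M)"
  by auto

lemma measurable_natural_filtration:
  assumes "0 \<le> u" "u \<le> t"
  shows "R u \<in> borel_measurable (natural_filtration M R t)"
proof (rule measurableI)
  fix A :: "real set" assume "A \<in> sets borel"
  then show "R u -` A \<inter> space (natural_filtration M R t) \<in> sets (natural_filtration M R t)"
    unfolding natural_filtration_def
    using assms by (auto simp: sets_measure_of[OF natural_filtration_generators] space_measure_of_conv)
qed auto

lemma subalgebra_natural_filtration:
  assumes "\<And>u. u \<ge> 0 \<Longrightarrow> R u \<in> borel_measurable M"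
  shows "subalgebra M (natural_filtration M R t)"
  unfolding subalgebra_def space_natural_filtration
proof
  show "sets (natural_filtration M R t) \<subseteq> sets M"
    unfolding natural_filtration_def sets_measure_of[OF natural_filtration_generators]
    by (intro sets.sigma_sets_subset) (use assms measurable_sets in auto)
qed simp

text \<open>The only form in which the martingale property is used: an increment after t has mean
  zero on every event known at t.\<close>

lemma martingale_increment:
  assumes "prob_space M" "\<And>u. u \<ge> 0 \<Longrightarrow> R u \<in> borel_measurable M"
    and X: "martingale M (natural_filtration M R) X"
    and t: "0 \<le> t" "t \<le> u" and A: "A \<in> sets (natural_filtration M R t)"
  shows "integrable M (\<lambda>\<omega>. indicator A \<omega> * (X u \<omega> - X t \<omega>))"
    and "(\<integral>\<omega>. indicator A \<omega> * (X u \<omega> - X t \<omega>) \<partial>M) = 0"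
proof -
  interpret prob_space M by fact
  have sub: "subalgebra M (natural_filtration M R t)"
    by (rule subalgebra_natural_filtration) fact
  interpret finite_measure_subalgebra M "natural_filtration M R t"
    by standard (rule sub)
  have AM: "A \<in> sets M" using sub A by (auto simp: subalgebra_def)
  have int: "integrable M (X u)" "integrable M (X t)"
    using X t by (auto simp: martingale_def)
  have intA: "integrable M (\<lambda>\<omega>. indicator A \<omega> * X u \<omega>)" "integrable M (\<lambda>\<omega>. indicator A \<omega> * X t \<omega>)"
    using integrable_real_mult_indicator[OF AM int(1)] integrable_real_mult_indicator[OF AM int(2)]
    by (simp_all add: mult.commute)
  then show "integrable M (\<lambda>\<omega>. indicator A \<omega> * (X u \<omega> - X t \<omega>))"
    by (simp add: right_diff_distrib)
  have "AE \<omega> in M. real_cond_exp M (natural_filtration M R t) (X u) \<omega> = X t \<omega>"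
    using X t by (auto simp: martingale_def)
  then have "(\<integral>\<omega>\<in>A. real_cond_exp M (natural_filtration M R t) (X u) \<omega> \<partial>M) = (\<integral>\<omega>\<in>A. X t \<omega> \<partial>M)"
    using AM by (intro set_lebesgue_integral_cong_AE) (use int in \<open>auto intro!: borel_measurable_integrable\<close>)
  with real_cond_exp_intA[OF int(1) A] intA
  show "(\<integral>\<omega>. indicator A \<omega> * (X u \<omega> - X t \<omega>) \<partial>M) = 0"
    by (simp add: right_diff_distrib set_lebesgue_integral_def)
qed

section \<open>Optional stopping for space-time functions\<close>

text \<open>Here \<open>r\<close> is a path and \<open>T\<close> its hitting time of \<open>\<epsilon>\<close>; \<open>f u\<close> is an extension of \<open>F u\<close> below
  \<open>\<epsilon>\<close>, and \<open>L u\<close> its image under the generator. By \<open>F_deriv\<close>, the function \<open>F\<close> is space-time harmonic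
  above \<open>\<epsilon>\<close>, so the increments of \<open>P u\<close> over \<open>[u, w]\<close> differ from those of \<open>F\<close> along the path
  by \<open>o(w - u)\<close> as long as \<open>w \<le> T\<close>.\<close>

locale stopped_path =
  fixes r :: "real \<Rightarrow> real" and T :: ereal and \<epsilon> C :: real
    and F G f L :: "real \<Rightarrow> real \<Rightarrow> real"
  assumes r_cont: "continuous_on {0..} r"
    and T_nonneg: "0 \<le> T"
    and r_ge: "\<And>v. 0 \<le> v \<Longrightarrow> ereal v \<le> T \<Longrightarrow> \<epsilon> \<le> r v"
    and F_deriv: "\<And>u x. 0 \<le> u \<Longrightarrow> \<epsilon> \<le> x \<Longrightarrow> ((\<lambda>u. F u x) has_real_derivative - G u x) (at u)"
    and F_cont: "continuous_on ({0..} \<times> {\<epsilon>..}) (\<lambda>(u, x). F u x)"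
    and G_cont: "continuous_on ({0..} \<times> {\<epsilon>..}) (\<lambda>(u, x). G u x)"
    and F_le: "\<And>u x. 0 \<le> u \<Longrightarrow> \<epsilon> \<le> x \<Longrightarrow> \<bar>F u x\<bar> \<le> C"
    and G_le: "\<And>u x. 0 \<le> u \<Longrightarrow> \<epsilon> \<le> x \<Longrightarrow> \<bar>G u x\<bar> \<le> C"
    and f_eq: "\<And>u x. 0 \<le> u \<Longrightarrow> \<epsilon> \<le> x \<Longrightarrow> f u x = F u x"
    and L_eq: "\<And>u x. 0 \<le> u \<Longrightarrow> \<epsilon> \<le> x \<Longrightarrow> L u x = G u x"
begin

definition stop :: "real \<Rightarrow> real" where
  "stop u = real_of_ereal (min (ereal u) T)"

text \<open>The process of the martingale problem along one fixed path, for the test function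
  \<open>f u\<close> whose time argument is frozen at u.\<close>

definition P :: "real \<Rightarrow> real \<Rightarrow> real" where
  "P u w = f u (r (stop w)) - f u (r 0) - (LINT v:{0..stop w}|lborel. L u (r v))"

definition defect :: "real \<Rightarrow> real \<Rightarrow> real" where
  "defect u w = P u w - P u u - (F w (r (stop w)) - F u (r (stop u)))"

lemma stop_props:
  assumes "0 \<le> u"
  shows "0 \<le> stop u" "stop u \<le> u" "ereal (stop u) \<le> T"
    and "u \<le> w \<Longrightarrow> stop u \<le> stop w" "u \<le> w \<Longrightarrow> stop w - stop u \<le> w - u"
    and "ereal u \<le> T \<Longrightarrow> stop u = u"
    and "0 \<le> m \<Longrightarrow> m \<le> u \<Longrightarrow> ereal m \<le> T \<Longrightarrow> m \<le> stop u"
    and "\<epsilon> \<le> r (stop u)"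
proof -
  have T: "(\<exists>T'\<ge>0. T = ereal T') \<or> T = \<infinity>"
    using T_nonneg by (cases T) auto
  have stop_eq: "stop u = (if ereal u \<le> T then u else real_of_ereal T)" for u
    by (simp add: stop_def min_def)
  show *: "0 \<le> stop u" "stop u \<le> u" "ereal (stop u) \<le> T"
    using assms T by (auto simp: stop_eq)
  show "u \<le> w \<Longrightarrow> stop u \<le> stop w" "u \<le> w \<Longrightarrow> stop w - stop u \<le> w - u"
    using assms T by (auto simp: stop_eq)
  show "ereal u \<le> T \<Longrightarrow> stop u = u" "0 \<le> m \<Longrightarrow> m \<le> u \<Longrightarrow> ereal m \<le> T \<Longrightarrow> m \<le> stop u"
    using assms T by (auto simp: stop_eq)
  show "\<epsilon> \<le> r (stop u)" using r_ge * by auto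
qed

lemma stop_0: "stop 0 = 0"
  using stop_props(1,2)[of 0] by simp

lemma path_ge: "v \<in> {0..stop w} \<Longrightarrow> 0 \<le> w \<Longrightarrow> \<epsilon> \<le> r v"
  using stop_props(3)[of w] r_ge[of v] by (meson atLeastAtMost_iff ereal_less_eq(3) order_trans)

lemma G_path_cont:
  assumes "0 \<le> u" "0 \<le> w"
  shows "continuous_on {0..stop w} (\<lambda>v. G u (r v))"
proof -
  have "continuous_on {0..stop w} (\<lambda>v. (u, r v))"
    by (intro continuous_intros continuous_on_subset[OF r_cont]) auto
  moreover have "(\<lambda>v. (u, r v)) ` {0..stop w} \<subseteq> {0..} \<times> {\<epsilon>..}"
    using path_ge[of _ w] assms by auto
  ultimately show ?thesis
    using continuous_on_compose2[OF G_cont] by fastforce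
qed

lemma L_integral:
  assumes "0 \<le> u" "0 \<le> w"
  shows "(LINT v:{0..stop w}|lborel. L u (r v)) = integral {0..stop w} (\<lambda>v. G u (r v))"
proof -
  have "(LINT v:{0..stop w}|lborel. L u (r v)) = (LINT v:{0..stop w}|lborel. G u (r v))"
    by (intro set_lebesgue_integral_cong) (use assms path_ge L_eq in auto)
  also have "\<dots> = integral {0..stop w} (\<lambda>v. G u (r v))"
    by (intro set_borel_integral_eq_integral borel_integrable_atLeastAtMost' G_path_cont assms)
  finally show ?thesis .
qed

text \<open>Freezing the time argument leaves two terms. The change of \<open>F\<close> in time at
  the fixed point \<open>r (stop w)\<close> gives (w - u) G by the mean value theorem; the
  compensator of \<open>P\<close> gives the integral of G over the part of [u, w] before
  stopping.\<close>

lemma defect_eq: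
  assumes u: "0 \<le> u" "u < w"
  obtains \<xi> where "u < \<xi>" "\<xi> < w"
    "defect u w = (w - u) * G \<xi> (r (stop w)) - integral {stop u..stop w} (\<lambda>v. G u (r v))"
proof -
  have w: "0 \<le> w" using u by simp
  have "integral {0..stop u} (\<lambda>v. G u (r v)) + integral {stop u..stop w} (\<lambda>v. G u (r v))
      = integral {0..stop w} (\<lambda>v. G u (r v))"
    by (intro Henstock_Kurzweil_Integration.integral_combine integrable_continuous_real G_path_cont)
      (use u w stop_props in auto)
  moreover have "defect u w = F u (r (stop w)) - F w (r (stop w))
      - (integral {0..stop w} (\<lambda>v. G u (r v)) - integral {0..stop u} (\<lambda>v. G u (r v)))"
    using u w stop_props(8) by (simp add: defect_def P_def L_integral f_eq)
  moreover obtain \<xi> where "u < \<xi>" "\<xi> < w"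
    "F w (r (stop w)) - F u (r (stop w)) = (w - u) * - G \<xi> (r (stop w))"
    using MVT2[OF u(2), of "\<lambda>u. F u (r (stop w))" "\<lambda>u. - G u (r (stop w))"]
      F_deriv stop_props(8)[OF w] u by force
  ultimately show ?thesis using that by fastforce
qed

lemma defect_bound:
  assumes u: "0 \<le> u" "u < w"
  shows "\<bar>defect u w\<bar> \<le> 2 * C * (w - u)"
proof -
  obtain \<xi> where \<xi>: "u < \<xi>" "\<xi> < w"
    and d: "defect u w = (w - u) * G \<xi> (r (stop w)) - integral {stop u..stop w} (\<lambda>v. G u (r v))"
    using defect_eq[OF u] by metis
  have C: "0 \<le> C" using G_le[of u "r (stop u)"] stop_props(8)[of u] u by simp
  have "norm (integral {stop u..stop w} (\<lambda>v. G u (r v))) \<le> C * (stop w - stop u)"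
    by (rule integral_bound)
      (use u stop_props[of u] path_ge[of _ w] G_le in \<open>auto intro!: continuous_on_subset[OF G_path_cont[of u w]]\<close>)
  also have "\<dots> \<le> C * (w - u)"
    using C stop_props(5)[of u w] u by (intro mult_left_mono) auto
  finally have "\<bar>integral {stop u..stop w} (\<lambda>v. G u (r v))\<bar> \<le> C * (w - u)" by simp
  moreover have "\<bar>(w - u) * G \<xi> (r (stop w))\<bar> \<le> (w - u) * C"
    unfolding abs_mult using u \<xi> G_le[of \<xi> "r (stop w)"] stop_props(8)[of w]
    by (intro mult_mono) auto
  moreover have "2 * C * (w - u) = C * (w - u) + (w - u) * C" by simp
  ultimately show ?thesis unfolding d by linarith
qed

text \<open>If stopping does not occur before w, both terms of \<open>defect_eq\<close> extend over
  the full length w - u, and only the oscillation of G remains. On an interval containing the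
  stopping time the lengths differ, and just the crude \<open>defect_bound\<close> is
  available.\<close>

lemma defect_bound_continuity:
  assumes u: "0 \<le> u" "u < w" and w: "ereal w \<le> T"
    and \<eta>: "\<And>\<xi> v. \<xi> \<in> {u..w} \<Longrightarrow> v \<in> {u..w} \<Longrightarrow> \<bar>G \<xi> (r w) - G u (r v)\<bar> \<le> \<eta>"
  shows "\<bar>defect u w\<bar> \<le> \<eta> * (w - u)"
proof -
  have "ereal u \<le> T" using u w by (meson ereal_less_eq(3) less_imp_le order_trans)
  then have stop: "stop u = u" "stop w = w" using stop_props(6) u w by auto
  obtain \<xi> where \<xi>: "u < \<xi>" "\<xi> < w"
    and d: "defect u w = (w - u) * G \<xi> (r w) - integral {u..w} (\<lambda>v. G u (r v))"
    using defect_eq[OF u] unfolding stop by metis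
  have cont: "continuous_on {u..w} (\<lambda>v. G u (r v))"
    by (rule continuous_on_subset[OF G_path_cont[of u w]]) (use u stop in auto)
  have "defect u w = integral {u..w} (\<lambda>v. G \<xi> (r w) - G u (r v))"
    unfolding d using u cont
    by (subst Henstock_Kurzweil_Integration.integral_diff) (auto intro: integrable_continuous_real)
  also have "norm \<dots> \<le> \<eta> * (w - u)"
    using u \<xi> by (intro integral_bound continuous_intros cont) (auto intro!: \<eta>)
  finally show ?thesis by simp
qed

section \<open>Sums of increments over a time grid along a single path\<close>

context
  fixes t m :: real
  assumes t: "0 < t" and m: "0 \<le> m" "m \<le> t" "ereal m \<le> T"
begin

definition mesh :: "nat \<Rightarrow> nat \<Rightarrow> real" where
  "mesh n k = t * (real k / real (Suc n))"

text \<open>The ceiling counts the intervals whose left end lies strictly before m. Hence inclusion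
  of an interval is decided at its left end, as \<open>martingale_increment\<close> requires, and
  the last right end is the first grid point at or after m.\<close>

definition steps :: "nat \<Rightarrow> nat" where
  "steps n = nat \<lceil>m / t * real (Suc n)\<rceil>"

lemma mesh_props: "0 \<le> mesh n k" "mesh n k < mesh n (Suc k)"
  "mesh n (Suc k) - mesh n k = t / real (Suc n)"
proof -
  show "0 \<le> mesh n k" using t by (simp add: mesh_def)
  have "real (Suc k) / real (Suc n) = real k / real (Suc n) + 1 / real (Suc n)"
    by (simp only: of_nat_Suc[of k] add_divide_distrib add.commute)
  then show *: "mesh n (Suc k) - mesh n k = t / real (Suc n)"
    unfolding mesh_def by (simp only: distrib_left) simp
  have "0 < t / real (Suc n)" using t by simp
  with * show "mesh n k < mesh n (Suc k)" by linarith
qed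

lemma less_steps_iff: "k < steps n \<longleftrightarrow> mesh n k < m"
proof -
  have "k < steps n \<longleftrightarrow> real k < m / t * real (Suc n)"
    unfolding steps_def by (simp add: zless_nat_eq_int_zless less_ceiling_iff del: of_nat_Suc)
  also have "\<dots> \<longleftrightarrow> mesh n k < m"
    using t by (simp add: mesh_def field_simps del: of_nat_Suc)
  finally show ?thesis .
qed

lemma steps_le: "steps n \<le> Suc n"
proof -
  have "\<not> mesh n (Suc n) < m" using m by (simp add: mesh_def)
  then show ?thesis using less_steps_iff[of "Suc n" n] by simp
qed

lemma increments_telescope:
  "(\<Sum>k<steps n. P (mesh n k) (mesh n (Suc k)) - P (mesh n k) (mesh n k))
    = F (mesh n (steps n)) (r (stop (mesh n (steps n)))) - F 0 (r 0)
      + (\<Sum>k<steps n. defect (mesh n k) (mesh n (Suc k)))"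
proof -
  have "(\<Sum>k<steps n. P (mesh n k) (mesh n (Suc k)) - P (mesh n k) (mesh n k))
    = (\<Sum>k<steps n. F (mesh n (Suc k)) (r (stop (mesh n (Suc k)))) - F (mesh n k) (r (stop (mesh n k))))
      + (\<Sum>k<steps n. defect (mesh n k) (mesh n (Suc k)))"
    unfolding sum.distrib[symmetric] by (simp add: defect_def)
  then show ?thesis
    by (subst (asm) sum_lessThan_telescope[where f = "\<lambda>k. F (mesh n k) (r (stop (mesh n k)))"])
      (simp add: mesh_def stop_0)
qed

text \<open>A bound uniform in n and in the path, used as the dominating constant. The two end
  values of F contribute 2 C, and at most n + 1 defects of size 2 C t/(n + 1) contribute the
  rest.\<close>

lemma increments_bound:
  "\<bar>\<Sum>k<steps n. P (mesh n k) (mesh n (Suc k)) - P (mesh n k) (mesh n k)\<bar> \<le> 2 * C + 2 * C * t"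
proof -
  have C: "0 \<le> C" using G_le[of 0 "r 0"] stop_props(8)[of 0] by (simp add: stop_0)
  have "\<bar>\<Sum>k<steps n. defect (mesh n k) (mesh n (Suc k))\<bar> \<le> (\<Sum>k<steps n. 2 * C * (t / real (Suc n)))"
    by (rule order_trans[OF sum_abs], rule sum_mono)
      (use defect_bound mesh_props in metis)
  also have "\<dots> = real (steps n) * (2 * C * (t / real (Suc n)))" by simp
  also have "\<dots> \<le> real (Suc n) * (2 * C * (t / real (Suc n)))"
    using steps_le[of n] C t by (intro mult_right_mono) (auto simp del: of_nat_Suc)
  also have "\<dots> = 2 * C * t" by (simp del: of_nat_Suc)
  finally show ?thesis
    unfolding increments_telescope
    using F_le[of "mesh n (steps n)" "r (stop (mesh n (steps n)))"] F_le[of 0 "r 0"]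
      mesh_props(1) stop_props(8)[of "mesh n (steps n)"] stop_props(8)[of 0]
    by (simp add: stop_0)
qed

text \<open>Uniform continuity of G along the path on a compact rectangle makes every defect up to
  the last but one at most \<eta> times the mesh, in total \<eta> t = e/2. The last interval may
  reach beyond m and T; its crude bound is one mesh length times a constant, which also tends to
  0.\<close>

lemma defects_tendsto_0:
  "(\<lambda>n. \<Sum>k<steps n. defect (mesh n k) (mesh n (Suc k))) \<longlonglongrightarrow> 0"
proof (rule LIMSEQ_I)
  fix e :: real assume e: "e > 0"
  define \<eta> where "\<eta> = e / (2 * t)"
  have \<eta>: "\<eta> > 0" using e t by (simp add: \<eta>_def)
  have C: "0 \<le> C" using G_le[of 0 "r 0"] stop_props(8)[of 0] by (simp add: stop_0)
  have "continuous_on ({0..t} \<times> {0..m}) (\<lambda>p. (fst p, r (snd p)))"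
    by (intro continuous_intros continuous_on_compose2[OF r_cont]) auto
  moreover have "(\<lambda>p. (fst p, r (snd p))) ` ({0..t} \<times> {0..m}) \<subseteq> {0..} \<times> {\<epsilon>..}"
    using path_ge[of _ m] stop_props(6)[of m] m by auto
  ultimately have "continuous_on ({0..t} \<times> {0..m}) (\<lambda>p. G (fst p) (r (snd p)))"
    using continuous_on_compose2[OF G_cont] by fastforce
  then have "uniformly_continuous_on ({0..t} \<times> {0..m}) (\<lambda>p. G (fst p) (r (snd p)))"
    by (intro compact_uniformly_continuous compact_Times) auto
  then obtain \<delta> where \<delta>: "\<delta> > 0" and unif: "\<And>p q. p \<in> {0..t} \<times> {0..m} \<Longrightarrow> q \<in> {0..t} \<times> {0..m}
      \<Longrightarrow> dist q p < \<delta> \<Longrightarrow> \<bar>G (fst q) (r (snd q)) - G (fst p) (r (snd p))\<bar> < \<eta>"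
    unfolding uniformly_continuous_on_def using \<eta> by (auto simp: dist_real_def)
  have lim: "(\<lambda>n. K * (t / real (Suc n))) \<longlonglongrightarrow> 0" for K
    using tendsto_mult_right_zero[OF lim_inverse_n'[THEN LIMSEQ_Suc], of "K * t"] by simp
  have "\<forall>\<^sub>F n in sequentially. 2 * (t / real (Suc n)) < \<delta> \<and> 2 * C * (t / real (Suc n)) < e / 2"
    using order_tendstoD(2)[OF lim[of 2] \<delta>] order_tendstoD(2)[OF lim[of "2 * C"], of "e / 2"] e
    by (auto elim: eventually_elim2)
  then have "\<forall>\<^sub>F n in sequentially. norm ((\<Sum>k<steps n. defect (mesh n k) (mesh n (Suc k))) - 0) < e"
  proof eventually_elim
    case (elim n)
    let ?h = "t / real (Suc n)"
    have h: "0 < ?h" using t by simp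
    have interior: "\<bar>defect (mesh n k) (mesh n (Suc k))\<bar> \<le> \<eta> * ?h" if k: "Suc k < steps n" for k
    proof -
      have le: "mesh n (Suc k) \<le> m" using less_steps_iff[of "Suc k" n] k by simp
      then have "ereal (mesh n (Suc k)) \<le> T" using m(3) by (meson ereal_less_eq(3) order_trans)
      moreover have "\<bar>G \<xi> (r (mesh n (Suc k))) - G (mesh n k) (r v)\<bar> \<le> \<eta>"
        if "\<xi> \<in> {mesh n k..mesh n (Suc k)}" "v \<in> {mesh n k..mesh n (Suc k)}" for \<xi> v
      proof -
        have "dist (\<xi>, mesh n (Suc k)) (mesh n k, v) \<le> dist \<xi> (mesh n k) + dist (mesh n (Suc k)) v"
          unfolding dist_prod_def by (simp add: sqrt_sum_squares_le_sum)
        also have "\<dots> \<le> 2 * ?h"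
          using that mesh_props(3)[of n k] by (simp add: dist_real_def)
        finally have "dist (\<xi>, mesh n (Suc k)) (mesh n k, v) < \<delta>" using elim by simp
        then show ?thesis
          using unif[of "(mesh n k, v)" "(\<xi>, mesh n (Suc k))"] that le m mesh_props(1)[of n k] by auto
      qed
      ultimately show ?thesis
        using defect_bound_continuity[OF mesh_props(1,2)[of n k], of \<eta>] mesh_props(3)[of n k] by simp
    qed
    have "\<bar>\<Sum>k<steps n. defect (mesh n k) (mesh n (Suc k))\<bar> \<le> \<eta> * t + 2 * C * ?h"
    proof (cases "steps n")
      case 0
      then show ?thesis using \<eta> t C by simp
    next
      case (Suc K)
      have "\<bar>\<Sum>k<K. defect (mesh n k) (mesh n (Suc k))\<bar> \<le> (\<Sum>k<K. \<eta> * ?h)"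
        by (rule order_trans[OF sum_abs], rule sum_mono) (use interior Suc in auto)
      also have "\<dots> = real K * (\<eta> * ?h)" by simp
      also have "\<dots> \<le> real (Suc n) * (\<eta> * ?h)"
        using steps_le[of n] Suc \<eta> t by (intro mult_right_mono) auto
      also have "\<dots> = \<eta> * t" by (simp del: of_nat_Suc)
      finally have "\<bar>\<Sum>k<K. defect (mesh n k) (mesh n (Suc k))\<bar> \<le> \<eta> * t" .
      moreover have "\<bar>defect (mesh n K) (mesh n (Suc K))\<bar> \<le> 2 * C * ?h"
        using defect_bound[OF mesh_props(1,2)] mesh_props(3) by metis
      ultimately show ?thesis unfolding Suc by simp
    qed
    also have "\<dots> < e"
      using elim t by (simp add: \<eta>_def)
    finally show ?case by simp
  qed
  then show "\<exists>no. \<forall>n\<ge>no. norm ((\<Sum>k<steps n. defect (mesh n k) (mesh n (Suc k))) - 0) < e"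
    by (simp add: eventually_sequentially)
qed

lemma increments_tendsto:
  "(\<lambda>n. \<Sum>k<steps n. P (mesh n k) (mesh n (Suc k)) - P (mesh n k) (mesh n k))
    \<longlonglongrightarrow> F m (r m) - F 0 (r 0)"
proof -
  have "(\<lambda>n. mesh n (steps n)) \<longlonglongrightarrow> t * (m / t)"
    unfolding mesh_def steps_def
    by (intro tendsto_mult tendsto_const tendsto_ceiling_fraction) (use t m in auto)
  then have lim: "(\<lambda>n. mesh n (steps n)) \<longlonglongrightarrow> m" using t by simp
  have ge: "m \<le> mesh n (steps n)" for n
    using less_steps_iff[of "steps n" n] by simp
  \<comment> \<open>The last grid point may lie beyond T, but the stopped time is still squeezed
    between m and that grid point.\<close>
  have "(\<lambda>n. stop (mesh n (steps n))) \<longlonglongrightarrow> m"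
  proof (rule real_tendsto_sandwich[where f = "\<lambda>_. m" and h = "\<lambda>n. mesh n (steps n)"])
    show "\<forall>\<^sub>F n in sequentially. m \<le> stop (mesh n (steps n))"
      using stop_props(7)[OF mesh_props(1) m(1) ge m(3)] by simp
    show "\<forall>\<^sub>F n in sequentially. stop (mesh n (steps n)) \<le> mesh n (steps n)"
      using stop_props(2)[OF mesh_props(1)] by simp
  qed (use lim in auto)
  then have "(\<lambda>n. r (stop (mesh n (steps n)))) \<longlonglongrightarrow> r m"
    by (rule continuous_on_tendsto_compose[OF r_cont])
      (use m stop_props(1)[OF mesh_props(1)] in auto)
  with lim have "(\<lambda>n. (mesh n (steps n), r (stop (mesh n (steps n))))) \<longlonglongrightarrow> (m, r m)"
    by (rule tendsto_Pair)
  from continuous_on_tendsto_compose[OF F_cont this]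
  have "(\<lambda>n. F (mesh n (steps n)) (r (stop (mesh n (steps n))))) \<longlonglongrightarrow> F m (r m)"
    using m r_ge mesh_props(1) stop_props(8)[OF mesh_props(1)] by auto
  from tendsto_add[OF tendsto_diff[OF this tendsto_const[of "F 0 (r 0)"]] defects_tendsto_0]
  show ?thesis unfolding increments_telescope by simp
qed

end

end

section \<open>Dynkin's formula for time-dependent functions of the Bessel process\<close>

lemma bessel_process_path:
  assumes "bessel_process M \<nu> x R" "\<omega> \<in> space M"
  shows "R 0 \<omega> = x" "continuous_on {0..} (\<lambda>u. R u \<omega>)"
  using assms by (auto simp: bessel_process_def)

lemma bessel_process_measurable:
  "bessel_process M \<nu> x R \<Longrightarrow> u \<ge> 0 \<Longrightarrow> R u \<in> borel_measurable M"
  by (simp add: bessel_process_def)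

text \<open>Each term of \<open>Z n\<close> has mean zero, since whether \<sigma> exceeds a grid
  point is known at that point. Along every path \<open>Z n\<close> equals the grid sum of
  \<open>stopped_path\<close>, which converges boundedly to the increment of F up to
  \<open>m \<omega>\<close>. Dominated convergence passes the mean zero to the limit.\<close>

lemma bessel_dynkin:
  fixes M :: "'a measure" and \<sigma> :: "'a \<Rightarrow> ereal" and F G f :: "real \<Rightarrow> real \<Rightarrow> real"
  assumes M: "prob_space M" and R: "bessel_process M \<nu> x R" and \<epsilon>: "0 < \<epsilon>" "\<epsilon> < x"
    and \<sigma>: "\<And>\<omega>. \<omega> \<in> space M \<Longrightarrow> 0 \<le> \<sigma> \<omega>" "\<And>\<omega>. \<omega> \<in> space M \<Longrightarrow> \<sigma> \<omega> \<le> hitting_time R \<epsilon> \<omega>"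
    and stopping: "\<And>u. 0 \<le> u \<Longrightarrow> {\<omega> \<in> space M. ereal u < \<sigma> \<omega>} \<in> sets (natural_filtration M R u)"
    and F_deriv: "\<And>u x. 0 \<le> u \<Longrightarrow> \<epsilon> \<le> x \<Longrightarrow> ((\<lambda>u. F u x) has_real_derivative - G u x) (at u)"
    and F_cont: "continuous_on ({0..} \<times> {\<epsilon>..}) (\<lambda>(u, x). F u x)"
    and G_cont: "continuous_on ({0..} \<times> {\<epsilon>..}) (\<lambda>(u, x). G u x)"
    and F_le: "\<And>u x. 0 \<le> u \<Longrightarrow> \<epsilon> \<le> x \<Longrightarrow> \<bar>F u x\<bar> \<le> C"
    and G_le: "\<And>u x. 0 \<le> u \<Longrightarrow> \<epsilon> \<le> x \<Longrightarrow> \<bar>G u x\<bar> \<le> C"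
    and f_C2: "\<And>u. 0 \<le> u \<Longrightarrow> C2_bounded (f u)"
    and f_eq: "\<And>u x. 0 \<le> u \<Longrightarrow> \<epsilon> \<le> x \<Longrightarrow> f u x = F u x"
    and f_generator: "\<And>u x. 0 \<le> u \<Longrightarrow> \<epsilon> \<le> x \<Longrightarrow> bessel_generator \<nu> (f u) x = G u x"
    and t: "0 < t"
  defines "m \<equiv> (\<lambda>\<omega>. real_of_ereal (min (ereal t) (\<sigma> \<omega>)))"
  shows "integrable M (\<lambda>\<omega>. F (m \<omega>) (R (m \<omega>) \<omega>))"
    and "(\<integral>\<omega>. F (m \<omega>) (R (m \<omega>) \<omega>) \<partial>M) = F 0 x"
proof -
  interpret prob_space M by (rule M)
  \<comment> \<open>The mesh depends on t alone, so all paths share one deterministic grid.\<close>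
  define grid where "grid = stopped_path.mesh t"
  define X where "X n k = generator_process \<nu> R (f (grid n k)) \<epsilon>" for n k
  define A where "A n k = {\<omega> \<in> space M. ereal (grid n k) < \<sigma> \<omega>}" for n k
  define Z where "Z n \<omega> = (\<Sum>k<Suc n. indicator (A n k) \<omega> * (X n k (grid n (Suc k)) \<omega> - X n k (grid n k) \<omega>))"
    for n \<omega>
  have path: "stopped_path (\<lambda>u. R u \<omega>) (hitting_time R \<epsilon> \<omega>) \<epsilon> C F G f (\<lambda>u. bessel_generator \<nu> (f u))"
    if \<omega>: "\<omega> \<in> space M" for \<omega>
  proof
    note Rp = bessel_process_path[OF R \<omega>]
    show "continuous_on {0..} (\<lambda>u. R u \<omega>)" by (rule Rp)
    have h: "continuous_on {0..} (\<lambda>u. R u \<omega> - \<epsilon>)" "R 0 \<omega> - \<epsilon> > 0"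
      using Rp(1,2) \<epsilon> by (auto intro!: continuous_intros)
    show "0 \<le> hitting_time R \<epsilon> \<omega>" using \<sigma>[OF \<omega>] by (rule order_trans)
    fix v assume "0 \<le> v" "ereal v \<le> hitting_time R \<epsilon> \<omega>"
    with h show "\<epsilon> \<le> R v \<omega>"
      unfolding hitting_time_eq_zero_time
      by (cases rule: zero_time_cases) (force simp: le_less)+
  qed (fact F_deriv F_cont G_cont F_le G_le f_eq f_generator)+
  have m: "0 \<le> m \<omega>" "m \<omega> \<le> t" "ereal (m \<omega>) \<le> hitting_time R \<epsilon> \<omega>"
    and less_m_iff: "u < m \<omega> \<longleftrightarrow> u < t \<and> ereal u < \<sigma> \<omega>" if "\<omega> \<in> space M" for \<omega> u
  proof -
    have "ereal (m \<omega>) = min (ereal t) (\<sigma> \<omega>)"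
      using \<sigma>(1)[OF that] t by (cases "\<sigma> \<omega>") (auto simp: m_def min_def)
    moreover have "0 \<le> min (ereal t) (\<sigma> \<omega>)"
      using \<sigma>(1)[OF that] t by simp
    ultimately show "0 \<le> m \<omega>" "m \<omega> \<le> t" "ereal (m \<omega>) \<le> hitting_time R \<epsilon> \<omega>"
      "u < m \<omega> \<longleftrightarrow> u < t \<and> ereal u < \<sigma> \<omega>"
      using \<sigma>(2)[OF that]
      by (metis ereal_less_eq(3) zero_ereal_def, metis ereal_less_eq(3) min.cobounded1,
        metis min.coboundedI2, metis less_ereal.simps(1) min_less_iff_conj)
  qed
  have grid_ge: "0 \<le> grid n k" "grid n k \<le> grid n (Suc k)" for n k
  proof -
    obtain \<omega> where \<omega>: "\<omega> \<in> space M" using not_empty by auto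
    show "0 \<le> grid n k" "grid n k \<le> grid n (Suc k)"
      using stopped_path.mesh_props(1,2)[OF path[OF \<omega>] t m[OF \<omega>], of n k] by (auto simp: grid_def)
  qed
  have Z_eq: "Z n \<omega> = (\<Sum>k<stopped_path.steps t (m \<omega>) n.
      stopped_path.P (\<lambda>u. R u \<omega>) (hitting_time R \<epsilon> \<omega>) f (\<lambda>u. bessel_generator \<nu> (f u)) (grid n k) (grid n (Suc k))
      - stopped_path.P (\<lambda>u. R u \<omega>) (hitting_time R \<epsilon> \<omega>) f (\<lambda>u. bessel_generator \<nu> (f u)) (grid n k) (grid n k))"
    if \<omega>: "\<omega> \<in> space M" for n \<omega>
  proof -
    interpret stopped_path "\<lambda>u. R u \<omega>" "hitting_time R \<epsilon> \<omega>" \<epsilon> C F G f "\<lambda>u. bessel_generator \<nu> (f u)"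
      by (rule path[OF \<omega>])
    have P_eq: "P (grid n k) w = X n k w \<omega>" for k w
      by (simp add: P_def X_def generator_process_def stop_def Let_def)
    \<comment> \<open>For k <= n the grid point lies before t, so lying before \<sigma> is the same
      as lying before min t \<sigma>. Thus the fixed range of summation in \<open>Z n\<close>
      reproduces the random number of steps.\<close>
    have A_iff: "\<omega> \<in> A n k \<longleftrightarrow> k < steps t (m \<omega>) n" if "k < Suc n" for k
    proof -
      have "grid n k < t"
        using that t mult_strict_left_mono[of "real k" "real (Suc n)" t] by (simp add: grid_def mesh_def[OF t m[OF \<omega>]] field_simps)
      then show ?thesis
        using less_steps_iff[OF t m[OF \<omega>], of k n] less_m_iff[OF \<omega>, of "grid n k"] \<omega>
        by (simp add: A_def grid_def)
    qed
    have "steps t (m \<omega>) n \<le> Suc n"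
      by (rule steps_le[OF t m[OF \<omega>]])
    then show ?thesis
      unfolding Z_def P_eq using A_iff
      by (intro sum.mono_neutral_cong_right) (auto simp: indicator_def)
  qed
  have int: "integrable M (\<lambda>\<omega>. indicator (A n k) \<omega> * (X n k (grid n (Suc k)) \<omega> - X n k (grid n k) \<omega>))"
    "(\<integral>\<omega>. indicator (A n k) \<omega> * (X n k (grid n (Suc k)) \<omega> - X n k (grid n k) \<omega>) \<partial>M) = 0" for n k
  proof -
    have "martingale M (natural_filtration M R) (X n k)"
      using R f_C2[OF grid_ge(1)] \<epsilon> by (simp add: bessel_process_def X_def)
    from martingale_increment[OF M bessel_process_measurable[OF R] this grid_ge]
    show "integrable M (\<lambda>\<omega>. indicator (A n k) \<omega> * (X n k (grid n (Suc k)) \<omega> - X n k (grid n k) \<omega>))"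
      "(\<integral>\<omega>. indicator (A n k) \<omega> * (X n k (grid n (Suc k)) \<omega> - X n k (grid n k) \<omega>) \<partial>M) = 0"
      using stopping[OF grid_ge(1)] by (simp_all add: A_def)
  qed
  have Z_int: "integrable M (Z n)" "(\<integral>\<omega>. Z n \<omega> \<partial>M) = 0" for n
  proof -
    show "integrable M (Z n)"
      unfolding Z_def[abs_def] by (rule Bochner_Integration.integrable_sum) (rule int)
    show "(\<integral>\<omega>. Z n \<omega> \<partial>M) = 0"
      unfolding Z_def by (subst Bochner_Integration.integral_sum[OF int(1)]) (simp only: int(2) sum.neutral_const)
  qed
  have lim: "(\<lambda>n. Z n \<omega>) \<longlonglongrightarrow> F (m \<omega>) (R (m \<omega>) \<omega>) - F 0 x" if \<omega>: "\<omega> \<in> space M" for \<omega>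
    using stopped_path.increments_tendsto[OF path[OF \<omega>] t m[OF \<omega>]]
    by (simp add: Z_eq[OF \<omega>] grid_def bessel_process_path[OF R \<omega>])
  have bound: "\<bar>Z n \<omega>\<bar> \<le> 2 * C + 2 * C * t" if \<omega>: "\<omega> \<in> space M" for \<omega> n
    using stopped_path.increments_bound[OF path[OF \<omega>] t m[OF \<omega>]]
    by (simp add: Z_eq[OF \<omega>] grid_def)
  have [measurable]: "Z n \<in> borel_measurable M" for n using Z_int by auto
  have meas: "(\<lambda>\<omega>. F (m \<omega>) (R (m \<omega>) \<omega>) - F 0 x) \<in> borel_measurable M"
    by (rule borel_measurable_LIMSEQ_real[of M Z]) (use lim in auto)
  note dct = meas _ integrable_const[of "2 * C + 2 * C * t"] AE_I2[OF lim] AE_I2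
  have "integrable M (\<lambda>\<omega>. F (m \<omega>) (R (m \<omega>) \<omega>) - F 0 x)"
    by (rule integrable_dominated_convergence[OF dct]) (use bound in auto)
  from Bochner_Integration.integrable_add[OF this integrable_const[of "F 0 x"]]
  show int_F: "integrable M (\<lambda>\<omega>. F (m \<omega>) (R (m \<omega>) \<omega>))" by simp
  have "(\<lambda>n. \<integral>\<omega>. Z n \<omega> \<partial>M) \<longlonglongrightarrow> (\<integral>\<omega>. F (m \<omega>) (R (m \<omega>) \<omega>) - F 0 x \<partial>M)"
    by (rule integral_dominated_convergence[OF dct]) (use bound in auto)
  then have "(\<integral>\<omega>. F (m \<omega>) (R (m \<omega>) \<omega>) - F 0 x \<partial>M) = 0"
    by (simp add: Z_int LIMSEQ_const_iff)
  then show "(\<integral>\<omega>. F (m \<omega>) (R (m \<omega>) \<omega>) \<partial>M) = F 0 x"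
    using int_F by (simp add: Bochner_Integration.integral_diff prob_space)
qed

section \<open>The crossing time\<close>

text \<open>Up to the first crossing the squared path is at least (b + u)/c > 0, so 0 has not been
  hit and the restriction to the lifetime holds automatically.\<close>

lemma crossing_time_eq_zero_time:
  assumes path: "R 0 \<omega> = 1" "continuous_on {0..} (\<lambda>u. R u \<omega>)" and bc: "0 < b" "b < c"
  shows "crossing_time R b c \<omega> = zero_time (\<lambda>u. (R u \<omega>)\<^sup>2 - (b + u) / c)"
    (is "_ = zero_time ?h")
proof (rule antisym)
  have sub: "{u. 0 \<le> u \<and> ereal u \<le> hitting_time R 0 \<omega> \<and> (R u \<omega>)\<^sup>2 = 1 / c * (b + u)} \<subseteq> {u. 0 \<le> u \<and> ?h u = 0}"
    by auto
  then show "zero_time ?h \<le> crossing_time R b c \<omega>"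
    unfolding zero_time_def crossing_time_def by (intro Inf_superset_mono image_mono)
  have "continuous_on {0..} ?h" "?h 0 > 0"
    using path bc by (auto intro!: continuous_intros)
  then show "crossing_time R b c \<omega> \<le> zero_time ?h"
  proof (cases rule: zero_time_cases)
    case (at w)
    have pos: "R u \<omega> \<noteq> 0" if "0 \<le> u" "u \<le> w" for u
    proof -
      have "0 < (b + u) / c" using that bc by simp
      also have "\<dots> \<le> (R u \<omega>)\<^sup>2" using at(3) at(4)[of u] that by (cases "u = w") auto
      finally show ?thesis by auto
    qed
    have "ereal w \<le> hitting_time R 0 \<omega>"
      unfolding hitting_time_def by (rule Inf_greatest) (use pos in force)
    then have "crossing_time R b c \<omega> \<le> ereal w"
      unfolding crossing_time_def by (intro Inf_lower imageI) (use at(2,3) in auto)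
    with at(1) show ?thesis by simp
  qed auto
qed

lemma bessel_crossing_stopping:
  assumes R: "bessel_process M \<nu> 1 R" and bc: "0 < b" "b < c" and u: "0 \<le> u"
  shows "{\<omega> \<in> space M. ereal u < crossing_time R b c \<omega>} \<in> sets (natural_filtration M R u)"
proof -
  note path = bessel_process_path[OF R]
  have "{\<omega> \<in> space (natural_filtration M R u). ereal u < zero_time (\<lambda>v. (R v \<omega>)\<^sup>2 - (b + v) / c)}
      \<in> sets (natural_filtration M R u)"
  proof (rule sets_less_zero_time)
    fix v assume "0 \<le> v" "v \<le> u"
    then have [measurable]: "R v \<in> borel_measurable (natural_filtration M R u)"
      by (rule measurable_natural_filtration)
    show "(\<lambda>\<omega>. (R v \<omega>)\<^sup>2 - (b + v) / c) \<in> borel_measurable (natural_filtration M R u)"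
      by measurable
  qed (use path bc u in \<open>auto intro!: continuous_intros\<close>)
  then show ?thesis
    using crossing_time_eq_zero_time[where R = R, OF path(1,2) bc] by (simp cong: conj_cong)
qed

text \<open>The level sqrt (b/c) is the square-root boundary at time 0, and that boundary rises; a
  path at this level has therefore already crossed. So the martingale problem stopped at this level
  covers all times up to \<sigma>.\<close>

lemma bessel_crossing_path:
  assumes R: "bessel_process M \<nu> 1 R" and bc: "0 < b" "b < c" and \<omega>: "\<omega> \<in> space M"
  shows "0 \<le> crossing_time R b c \<omega>"
    and "crossing_time R b c \<omega> \<le> hitting_time R (sqrt (b / c)) \<omega>"
    and "crossing_time R b c \<omega> = ereal w \<Longrightarrow> 0 \<le> w \<and> (R w \<omega>)\<^sup>2 = (b + w) / c"
    and "crossing_time R b c \<omega> = \<infinity> \<Longrightarrow> 0 \<le> u \<Longrightarrow> (R u \<omega>)\<^sup>2 > (b + u) / c"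
proof -
  note path = bessel_process_path[OF R \<omega>]
  define h where "h u = (R u \<omega>)\<^sup>2 - (b + u) / c" for u
  have eq: "crossing_time R b c \<omega> = zero_time h"
    unfolding h_def by (rule crossing_time_eq_zero_time[where R = R, OF path(1,2) bc])
  have h: "continuous_on {0..} h" "h 0 > 0"
    unfolding h_def[abs_def] using path(1,2) bc by (auto intro!: continuous_intros)
  show "0 \<le> crossing_time R b c \<omega>"
    unfolding eq zero_time_def by (rule Inf_greatest) auto
  show "crossing_time R b c \<omega> = ereal w \<Longrightarrow> 0 \<le> w \<and> (R w \<omega>)\<^sup>2 = (b + w) / c"
    unfolding eq using h by (cases rule: zero_time_cases) (auto simp: h_def)
  show "crossing_time R b c \<omega> = \<infinity> \<Longrightarrow> 0 \<le> u \<Longrightarrow> (R u \<omega>)\<^sup>2 > (b + u) / c"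
    unfolding eq using h by (cases rule: zero_time_cases) (auto simp: h_def)
  show "crossing_time R b c \<omega> \<le> hitting_time R (sqrt (b / c)) \<omega>"
    unfolding hitting_time_def
  proof (rule Inf_greatest)
    fix y assume "y \<in> ereal ` {u. 0 \<le> u \<and> R u \<omega> = sqrt (b / c)}"
    then obtain v where v: "y = ereal v" "0 \<le> v" "R v \<omega> = sqrt (b / c)" by auto
    then have "h v \<le> 0" using bc by (simp add: h_def field_simps)
    then have "\<not> ereal v < zero_time h"
      using less_zero_time_iff[OF h v(2)] v(2) by force
    then show "crossing_time R b c \<omega> \<le> y" by (simp add: eq v(1))
  qed
qed

text \<open>\<open>bessel_dynkin\<close> is applied up to min (n + 1) \<sigma>, and n tends to
  infinity under a constant bound. The right-hand side of the formula is F 0 1.\<close>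

lemma bessel_crossing_moment:
  assumes M: "prob_space M" and R: "bessel_process M \<nu> 1 R"
    and pos: "\<nu> > 0" "s > 0" and bc: "0 < b" "b < c"
  defines "Y \<equiv> (\<lambda>\<omega>. if crossing_time R b c \<omega> = \<infinity> then 0
      else (b + real_of_ereal (crossing_time R b c \<omega>)) powr (- s))"
  shows "integrable M Y"
    and "(\<integral>\<omega>. Y \<omega> \<partial>M) * gamma_resolvent (\<nu> + s) s (1 / c) = b powr (- s) * gamma_resolvent (\<nu> + s) s (1 / b)"
proof -
  interpret prob_space M by (rule M)
  define a where "a = \<nu> + s"
  define \<epsilon> where "\<epsilon> = sqrt (b / c)"
  define F where "F t x = scaled_resolvent a s (b + t) (x\<^sup>2)" for t x
  define G where "G t x = s / (b + t) * (F t x - x\<^sup>2 * scaled_resolvent a (s + 1) (b + t) (x\<^sup>2))" for t x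
  \<comment> \<open>For x >= \<epsilon> both F and x^2 times the resolvent of order s + 1 lie
    between 0 and (\<epsilon>^2)^(-s). The summand 1 covers F, and s/b covers the prefactor in
    G.\<close>
  define C where "C = (1 + s / b) * (\<epsilon>\<^sup>2) powr (- s)"
  have a: "a > 0" using pos by (simp add: a_def)
  have \<epsilon>: "0 < \<epsilon>" "\<epsilon> < 1" using bc by (simp_all add: \<epsilon>_def)
  have F_bounds: "0 \<le> F t x" "F t x \<le> (x\<^sup>2) powr (- s)" if "0 \<le> t" "\<epsilon> \<le> x" for t x
    using scaled_resolvent_le[of a s "b + t" "x\<^sup>2"] a pos bc \<epsilon> that
    by (auto simp: F_def scaled_resolvent_nonneg)
  have sq_powr: "(x\<^sup>2) powr (- s) \<le> (\<epsilon>\<^sup>2) powr (- s)" if "\<epsilon> \<le> x" for x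
    using that \<epsilon> pos by (intro powr_mono2') auto
  have C_ge: "(\<epsilon>\<^sup>2) powr (- s) \<le> C" "s / b * (\<epsilon>\<^sup>2) powr (- s) \<le> C"
    using pos bc by (simp_all add: C_def algebra_simps)
  have F_le: "\<bar>F t x\<bar> \<le> C" if "0 \<le> t" "\<epsilon> \<le> x" for t x
    using F_bounds[OF that] sq_powr[OF that(2)] C_ge by simp
  have G_le: "\<bar>G t x\<bar> \<le> C" if "0 \<le> t" "\<epsilon> \<le> x" for t x
  proof -
    have x2: "0 < x\<^sup>2" using that \<epsilon> by simp
    have "x\<^sup>2 * scaled_resolvent a (s + 1) (b + t) (x\<^sup>2) \<le> x\<^sup>2 * (x\<^sup>2) powr (- (s + 1))"
      using scaled_resolvent_le[of a "s + 1" "b + t" "x\<^sup>2"] a pos bc x2 that by (intro mult_left_mono) auto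
    also have "\<dots> = (x\<^sup>2) powr (- s)"
      using powr_eq_power_mult_powr[of "x\<^sup>2" "- s" "- (s + 1)" 1] x2 by simp
    finally have "x\<^sup>2 * scaled_resolvent a (s + 1) (b + t) (x\<^sup>2) \<le> (x\<^sup>2) powr (- s)" .
    moreover have "0 \<le> x\<^sup>2 * scaled_resolvent a (s + 1) (b + t) (x\<^sup>2)"
      by (simp add: scaled_resolvent_nonneg)
    ultimately have "\<bar>F t x - x\<^sup>2 * scaled_resolvent a (s + 1) (b + t) (x\<^sup>2)\<bar> \<le> (\<epsilon>\<^sup>2) powr (- s)"
      using F_bounds[OF that] sq_powr[OF that(2)] by linarith
    moreover have "s / (b + t) \<le> s / b" using pos bc that by (intro divide_left_mono) auto
    ultimately have "\<bar>G t x\<bar> \<le> s / b * (\<epsilon>\<^sup>2) powr (- s)"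
      unfolding G_def abs_mult using pos bc that by (intro mult_mono) auto
    then show ?thesis using C_ge by simp
  qed
  have F_deriv: "((\<lambda>t. F t x) has_real_derivative - G t x) (at t)" if "0 \<le> t" "\<epsilon> \<le> x" for t x
    unfolding F_def G_def
    by (rule DERIV_cong[OF DERIV_chain2[OF scaled_resolvent_scale_derivative]])
      (use a pos bc that \<epsilon> in \<open>auto intro!: derivative_eq_intros\<close>)
  have S_cont: "continuous_on ({0..} \<times> {\<epsilon>..}) (\<lambda>z. scaled_resolvent a p (b + fst z) ((snd z)\<^sup>2))" if "p \<ge> 0" for p
    by (intro continuous_on_scaled_resolvent continuous_intros) (use a that bc \<epsilon> in auto)
  have F_cont: "continuous_on ({0..} \<times> {\<epsilon>..}) (\<lambda>(t, x). F t x)"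
    using S_cont[of s] pos by (simp add: F_def case_prod_beta)
  have G_cont: "continuous_on ({0..} \<times> {\<epsilon>..}) (\<lambda>(t, x). G t x)"
    unfolding G_def F_def case_prod_beta
    by (intro continuous_intros S_cont) (use pos bc in auto)
  define m where "m n \<omega> = real_of_ereal (min (ereal (real (Suc n))) (crossing_time R b c \<omega>))" for n \<omega>
  define f where "f t x = scaled_resolvent a s (b + t) (smooth_square \<epsilon> x)" for t x
  have dynkin: "integrable M (\<lambda>\<omega>. F (m n \<omega>) (R (m n \<omega>) \<omega>))"
    "(\<integral>\<omega>. F (m n \<omega>) (R (m n \<omega>) \<omega>) \<partial>M) = F 0 1" for n
  proof -
    have f_C2: "C2_bounded (f t)" if "0 \<le> t" for t
      unfolding f_def using C2_bounded_scaled_resolvent(1)[of a s "b + t" \<epsilon>] a pos bc \<epsilon> that by simp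
    have f_eq: "f t x = F t x" if "0 \<le> t" "\<epsilon> \<le> x" for t x
      using that by (simp add: f_def F_def smooth_square_def)
    have f_gen: "bessel_generator \<nu> (f t) x = G t x" if "0 \<le> t" "\<epsilon> \<le> x" for t x
      using C2_bounded_scaled_resolvent(2)[of a s "b + t" \<epsilon> \<nu> x] a pos bc \<epsilon> that
      by (simp add: f_def[abs_def] F_def G_def a_def)
    note path = bessel_crossing_path[OF R bc]
    note D = bessel_dynkin[OF M R \<epsilon> path(1) path(2)[folded \<epsilon>_def] bessel_crossing_stopping[OF R bc]
      F_deriv F_cont G_cont F_le G_le f_C2 f_eq f_gen, of "real (Suc n)"]
    show "integrable M (\<lambda>\<omega>. F (m n \<omega>) (R (m n \<omega>) \<omega>))"
      "(\<integral>\<omega>. F (m n \<omega>) (R (m n \<omega>) \<omega>) \<partial>M) = F 0 1"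
      unfolding m_def by (rule D; simp)+
  qed
  define \<phi> where "\<phi> = gamma_resolvent a s (1 / c)"
  have lim: "(\<lambda>n. F (m n \<omega>) (R (m n \<omega>) \<omega>)) \<longlonglongrightarrow> Y \<omega> * \<phi>"
    and bound: "\<And>n. \<bar>F (m n \<omega>) (R (m n \<omega>) \<omega>)\<bar> \<le> C" if \<omega>: "\<omega> \<in> space M" for \<omega>
  proof -
    note path = bessel_crossing_path[OF R bc \<omega>] bessel_process_path[OF R \<omega>]
    show "(\<lambda>n. F (m n \<omega>) (R (m n \<omega>) \<omega>)) \<longlonglongrightarrow> Y \<omega> * \<phi>"
    proof (cases "crossing_time R b c \<omega>")
      case (real w)
      note w = path(3)[OF real]
      have "\<forall>\<^sub>F n in sequentially. m n \<omega> = w"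
        using eventually_ge_at_top[of "nat \<lceil>w\<rceil>"]
      proof eventually_elim
        case (elim n)
        then have "w \<le> real (Suc n)" by linarith
        then show ?case by (simp add: m_def real min_def)
      qed
      then have "\<forall>\<^sub>F n in sequentially. F (m n \<omega>) (R (m n \<omega>) \<omega>) = F w (R w \<omega>)"
        by eventually_elim simp
      then have "(\<lambda>n. F (m n \<omega>) (R (m n \<omega>) \<omega>)) \<longlonglongrightarrow> F w (R w \<omega>)"
        by (rule tendsto_eventually)
      \<comment> \<open>At the crossing the quotient x^2/(b + w) equals 1/c whatever w is; hence F
        splits into a power of b + w and a constant.\<close>
      also have "F w (R w \<omega>) = Y \<omega> * \<phi>"
        using w bc by (simp add: F_def scaled_resolvent_def Y_def real \<phi>_def)
      finally show ?thesis .
    next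
      case PInf
      have m_eq: "m n \<omega> = real (Suc n)" for n by (simp add: m_def PInf)
      \<comment> \<open>Without a crossing the squared path stays above (b + u)/c, which tends to
        infinity. Since s > 0, F tends to 0, matching the value 0 given to Y.\<close>
      have le: "F (real (Suc n)) (R (real (Suc n)) \<omega>) \<le> ((b + real (Suc n)) / c) powr (- s)"
        and nonneg: "0 \<le> F (real (Suc n)) (R (real (Suc n)) \<omega>)" for n
      proof -
        have gt: "(R (real (Suc n)) \<omega>)\<^sup>2 > (b + real (Suc n)) / c"
          by (rule path(4)[OF PInf]) simp
        have p: "0 < (b + real (Suc n)) / c" using bc by (intro divide_pos_pos) auto
        show "0 \<le> F (real (Suc n)) (R (real (Suc n)) \<omega>)" by (simp add: F_def scaled_resolvent_nonneg)
        have "F (real (Suc n)) (R (real (Suc n)) \<omega>) \<le> ((R (real (Suc n)) \<omega>)\<^sup>2) powr (- s)"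
          unfolding F_def by (rule scaled_resolvent_le) (use a pos bc less_trans[OF p gt] in linarith)+
        also have "\<dots> \<le> ((b + real (Suc n)) / c) powr (- s)"
          using p gt pos by (intro powr_mono2') auto
        finally show "F (real (Suc n)) (R (real (Suc n)) \<omega>) \<le> ((b + real (Suc n)) / c) powr (- s)" .
      qed
      have "filterlim (\<lambda>n. (b + real (Suc n)) / c) at_top sequentially"
        using bc by real_asymp
      then have lim: "(\<lambda>n. ((b + real (Suc n)) / c) powr (- s)) \<longlonglongrightarrow> 0"
        using pos by (intro tendsto_neg_powr) auto
      have "(\<lambda>n. F (real (Suc n)) (R (real (Suc n)) \<omega>)) \<longlonglongrightarrow> 0"
        by (rule real_tendsto_sandwich[OF _ _ tendsto_const lim];
          rule always_eventually; rule allI; rule nonneg le)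
      then show ?thesis by (simp add: m_eq Y_def PInf)
    next
      case MInf
      then show ?thesis using path(1) by simp
    qed
    fix n
    have "0 \<le> m n \<omega> \<and> ereal (m n \<omega>) \<le> crossing_time R b c \<omega>"
      using path(1) by (cases "crossing_time R b c \<omega>") (auto simp: m_def min_def)
    moreover have "\<epsilon> \<le> R u \<omega>" if u: "0 \<le> u" "ereal u \<le> crossing_time R b c \<omega>" for u
    proof -
      have h: "continuous_on {0..} (\<lambda>u. R u \<omega> - \<epsilon>)" "R 0 \<omega> - \<epsilon> > 0"
        using path(5,6) \<epsilon> by (auto intro!: continuous_intros)
      have "ereal u \<le> zero_time (\<lambda>u. R u \<omega> - \<epsilon>)"
        using path(2) u by (auto simp: hitting_time_eq_zero_time \<epsilon>_def)
      with h u show ?thesis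
        by (cases rule: zero_time_cases) (force simp: le_less)+
    qed
    ultimately show "\<bar>F (m n \<omega>) (R (m n \<omega>) \<omega>)\<bar> \<le> C"
      using F_le by blast
  qed
  have \<phi>: "\<phi> > 0" unfolding \<phi>_def using a pos bc by (intro gamma_resolvent_pos) auto
  have [measurable]: "(\<lambda>\<omega>. F (m n \<omega>) (R (m n \<omega>) \<omega>)) \<in> borel_measurable M" for n
    using dynkin(1) by auto
  have meas: "(\<lambda>\<omega>. Y \<omega> * \<phi>) \<in> borel_measurable M"
    by (rule borel_measurable_LIMSEQ_real[of M "\<lambda>n \<omega>. F (m n \<omega>) (R (m n \<omega>) \<omega>)"]) (use lim in auto)
  note dct = meas _ integrable_const[of C] AE_I2[OF lim] AE_I2
  have "integrable M (\<lambda>\<omega>. Y \<omega> * \<phi>)"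
    by (rule integrable_dominated_convergence[OF dct]) (use bound in auto)
  then show int_Y: "integrable M Y" using \<phi> by simp
  have "(\<lambda>n. \<integral>\<omega>. F (m n \<omega>) (R (m n \<omega>) \<omega>) \<partial>M) \<longlonglongrightarrow> (\<integral>\<omega>. Y \<omega> * \<phi> \<partial>M)"
    by (rule integral_dominated_convergence[OF dct]) (use bound in auto)
  then have "(\<integral>\<omega>. Y \<omega> * \<phi> \<partial>M) = F 0 1"
    by (simp add: dynkin(2) LIMSEQ_const_iff)
  then show "(\<integral>\<omega>. Y \<omega> \<partial>M) * gamma_resolvent (\<nu> + s) s (1 / c) = b powr (- s) * gamma_resolvent (\<nu> + s) s (1 / b)"
    by (simp add: F_def scaled_resolvent_def \<phi>_def a_def)
qed

text \<open>Compare the moment formula as \<open>s\<close> decreases to 0 with \<open>(b + \<sigma>)\<^sup>-\<^sup>s \<le> b\<^sup>-\<^sup>s\<close>.\<close>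

lemma prob_bessel_crosses:
  assumes M: "prob_space M" and R: "bessel_process M \<nu> 1 R" and \<nu>: "\<nu> > 0" and bc: "0 < b" "b < c"
  defines "E \<equiv> {\<omega> \<in> space M. crossing_time R b c \<omega> \<noteq> \<infinity>}"
  shows "E \<in> sets M" and "measure M E = 1"
proof -
  interpret prob_space M by (rule M)
  show E: "E \<in> sets M"
  proof -
    have "{\<omega> \<in> space M. ereal (real n) < crossing_time R b c \<omega>} \<in> sets M" for n
      using bessel_crossing_stopping[OF R bc, of "real n"]
        subalgebra_natural_filtration[of R M, OF bessel_process_measurable[OF R]]
      by (auto simp: subalgebra_def)
    then have "space M - (\<Inter>n. {\<omega> \<in> space M. ereal (real n) < crossing_time R b c \<omega>}) \<in> sets M"
      by (intro sets.Diff sets.top sets.countable_INT) auto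
    also have "space M - (\<Inter>n. {\<omega> \<in> space M. ereal (real n) < crossing_time R b c \<omega>}) = E"
    proof -
      have "(\<forall>n. ereal (real n) < y) \<longleftrightarrow> y = \<infinity>" for y
        by (cases y) (auto simp: not_less intro: real_arch_simple)
      then show ?thesis by (auto simp: E_def)
    qed
    finally show ?thesis .
  qed
  have ge: "b powr s * c powr (- s) \<le> prob E" if s: "s > 0" for s
  proof -
    define Y where "Y \<omega> = (if crossing_time R b c \<omega> = \<infinity> then 0
      else (b + real_of_ereal (crossing_time R b c \<omega>)) powr (- s))" for \<omega>
    note moment = bessel_crossing_moment[OF M R \<nu> s bc, folded Y_def]
    have "(\<integral>\<omega>. Y \<omega> \<partial>M) \<le> (\<integral>\<omega>. b powr (- s) * indicator E \<omega> \<partial>M)"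
    proof (rule integral_mono)
      show "integrable M Y" using moment(1) by (simp add: Y_def[abs_def])
      show "integrable M (\<lambda>\<omega>. b powr (- s) * indicator E \<omega>)"
        using E by (simp add: emeasure_eq_measure)
      fix \<omega> assume \<omega>: "\<omega> \<in> space M"
      show "Y \<omega> \<le> b powr (- s) * indicator E \<omega>"
        using bessel_crossing_path(1)[OF R bc \<omega>] \<omega> bc s
        by (cases "crossing_time R b c \<omega>") (auto simp: Y_def E_def intro!: powr_mono2')
    qed
    also have "\<dots> = b powr (- s) * prob E" using E by simp
    finally have Y_le: "(\<integral>\<omega>. Y \<omega> \<partial>M) \<le> b powr (- s) * prob E" .
    define \<phi> where "\<phi> d = gamma_resolvent (\<nu> + s) s (1 / d)" for d
    have \<phi>: "\<phi> c > 0" unfolding \<phi>_def using \<nu> s bc by (intro gamma_resolvent_pos) auto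
    \<comment> \<open>The factor \<open>\<phi> c\<close> varies with s but occurs on both ends of
      this chain and cancels, leaving the explicit bound (b/c)^s, which tends to 1.\<close>
    have "c powr (- s) * \<phi> c \<le> b powr (- s) * \<phi> b"
      unfolding \<phi>_def using \<nu> s bc by (intro gamma_resolvent_scaled_antimono) auto
    also have "\<dots> = (\<integral>\<omega>. Y \<omega> \<partial>M) * \<phi> c"
      using moment(2) by (simp add: Y_def[abs_def] \<phi>_def)
    also have "\<dots> \<le> b powr (- s) * prob E * \<phi> c"
      using Y_le \<phi> by (intro mult_right_mono) auto
    finally have "c powr (- s) \<le> b powr (- s) * prob E" using \<phi> by simp
    then have "b powr s * c powr (- s) \<le> b powr s * (b powr (- s) * prob E)"
      by (intro mult_left_mono) auto
    also have "\<dots> = prob E" using bc by (simp add: powr_minus)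
    finally show ?thesis .
  qed
  have "((\<lambda>s. b powr s * c powr (- s)) \<longlongrightarrow> b powr 0 * c powr (- 0)) (at_right 0)"
    using bc by (intro tendsto_intros) auto
  then have "b powr 0 * c powr (- 0) \<le> prob E"
    by (rule tendsto_upperbound) (auto simp: eventually_at_filter ge)
  then show "prob E = 1" using bc prob_le_1[of E] by simp
qed

theorem theorem1:
  fixes \<nu> b c s :: real
    and M :: "'a measure" and R :: "real \<Rightarrow> 'a \<Rightarrow> real"
    and N :: "'b measure" and G :: "'b \<Rightarrow> real"
  assumes "\<nu> > 0" and "0 < b" and "b < c" and "s \<ge> 0"
    and "prob_space M" and "bessel_process M \<nu> 1 R"
    and "prob_space N" and "distributed N lborel G (\<lambda>x. ennreal (gamma_density (\<nu> + s) x))"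
  shows "(\<integral>\<omega>. (if crossing_time R b c \<omega> = \<infinity> then 0
                else (b + real_of_ereal (crossing_time R b c \<omega>)) powr (- s)) \<partial>M)
       = c powr (- s) * ((\<integral>\<omega>. (1 + 2 * b * G \<omega>) powr (- s) \<partial>N)
                       / (\<integral>\<omega>. (1 + 2 * c * G \<omega>) powr (- s) \<partial>N))"
    (is "?lhs = ?rhs")
proof -
  have a: "\<nu> + s > 0" using assms by simp
  \<comment> \<open>Rescaling the gamma variable produces d^(-s) for d = b and d = c; the one for c
    cancels against the prefactor.\<close>
  have rhs: "?rhs = b powr (- s) * gamma_resolvent (\<nu> + s) s (1 / b) / gamma_resolvent (\<nu> + s) s (1 / c)"
    using gamma_expectation[OF assms(8) a, of b] gamma_expectation[OF assms(8) a, of c] assms by simp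
  show ?thesis
  proof (cases "s = 0")
    case False
    then have s: "s > 0" using assms by simp
    have "gamma_resolvent (\<nu> + s) s (1 / c) > 0"
      using assms by (intro gamma_resolvent_pos) auto
    with bessel_crossing_moment(2)[OF assms(5,6,1) s assms(2,3)] show ?thesis
      unfolding rhs by (simp add: field_simps)
  next
    case True
    \<comment> \<open>For s = 0 the integrand is 1 where a crossing occurs and 0 elsewhere, so the
      left side is the probability of a crossing, while both resolvents on the right equal
      1.\<close>
    note crosses = prob_bessel_crosses[OF assms(5,6,1-3)]
    have "?lhs = (\<integral>\<omega>. indicator {\<omega> \<in> space M. crossing_time R b c \<omega> \<noteq> \<infinity>} \<omega> \<partial>M)"
    proof (rule Bochner_Integration.integral_cong)
      fix \<omega> assume \<omega>: "\<omega> \<in> space M"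
      show "(if crossing_time R b c \<omega> = \<infinity> then 0
          else (b + real_of_ereal (crossing_time R b c \<omega>)) powr (- s))
          = indicator {\<omega> \<in> space M. crossing_time R b c \<omega> \<noteq> \<infinity>} \<omega>"
        using bessel_crossing_path(1)[OF assms(6,2,3) \<omega>] assms True \<omega>
        by (cases "crossing_time R b c \<omega>") auto
    qed simp
    also have "\<dots> = 1" using crosses by simp
    finally show ?thesis
      unfolding rhs using assms True by (simp add: gamma_resolvent_0)
  qed
qed

end
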